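(* Let $\mathbf{k}$ be a field of characteristic zero and $X=\{x_1,\dots,x_m\}$ a finite set. For every integer $k\ge 1$, $S_X^k$ and $L_X^k$ are orthogonal vector subspaces of $\mathrm{Ass}_X^k$ with respect to the bilinear form $\langle\cdot,\cdot\rangle$, and $$\mathrm{Ass}_X^k=L_X^k\oplus S_X^k .$$
   Context: $\mathrm{Ass}_X$ is the free associative unital $\mathbf{k}$-algebra on $X$ (non-commutative polynomials in $x_1,\dots,x_m$ with coefficients in $\mathbf{k}$), graded by degree; $L_X\subset \mathrm{Ass}_X$ is the free Lie algebra on $X$, i.e. the Lie subalgebra generated by $x_1,\dots,x_m$ for the bracket $[x,y]=xy-yx$. $\mathrm{Ass}_X^k$ and $L_X^k$ denote the homogeneous components of degree $k$. $\langle\cdot,\cdot\rangle$ is the symmetric $\mathbf{k}$-bilinear form on $\mathrm{Ass}_X$ for which the monomials form an orthonormal basis: $\langle x_{i_1}\cdots x_{i_r},x_{j_1}\cdots x_{j_s}\rangle=1$ if $r=s$ and $i_1=j_1,\dots,i_r=j_r$, and $0$ otherwise. Shuffle product: for $\omega_1,\dots,\omega_{r+s}\in \mathrm{Ass}_X^1$, $\omega_1\cdots\omega_r * \omega_{r+1}\cdots\omega_{r+s}=\sum \omega_{k_1}\omega_{k_2}\cdots\omega_{k_{r+s}}$, where $(k_1,\dots,k_{r+s})$ runs over all permutations of $(1,\dots,r+s)$ in which $1,\dots,r$ appear in their original order and $r+1,\dots,r+s$ appear in their original order. It is extended $\mathbf{k}$-bilinearly to $\mathrm{Ass}_X$. $S_X^k\subset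 \mathrm{Ass}_X^k$ is the $\mathbf{k}$-span of all $\omega_1*\omega_2$ with $\omega_1\in \mathrm{Ass}_X^{k_1}$, $\omega_2\in \mathrm{Ass}_X^{k_2}$, $k_1,k_2\ge 1$, $k_1+k_2=k$. *)

theory Defs
  imports Complex_Main "HOL-Library.Poly_Mapping" "HOL-Combinatorics.Permutations"
begin

text \<open>
  The free associative algebra is the monoid algebra of the free monoid. Words are wrapped in their
  own type so that they can be made an instance of \<^class>\<open>monoid_add\<close> (addition is concatenation);
  \<open>'x word \<Rightarrow>\<^sub>0 'k\<close> then carries the convolution product of \<^theory>\<open>HOL-Library.Poly_Mapping\<close>,
  which is the product of non-commutative polynomials.
\<close>

datatype 'x word = Word (letters: "'x list")

instantiation word :: (type) monoid_add
begin

definition zero_word :: "'a word" where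
  "0 = Word []"

definition plus_word :: "'a word \<Rightarrow> 'a word \<Rightarrow> 'a word" where
  "u + v = Word (letters u @ letters v)"

instance
  by standard (auto simp: zero_word_def plus_word_def)

end

type_synonym ('x, 'k) ncpoly = "'x word \<Rightarrow>\<^sub>0 'k"

definition monom :: "'x list \<Rightarrow> ('x, 'k::zero_neq_one) ncpoly" where
  "monom xs = Poly_Mapping.single (Word xs) 1"

abbreviation gen :: "'x \<Rightarrow> ('x, 'k::zero_neq_one) ncpoly" where
  "gen x \<equiv> monom [x]"

definition scale :: "'k::field \<Rightarrow> ('x, 'k) ncpoly \<Rightarrow> ('x, 'k) ncpoly" where
  "scale c p = Poly_Mapping.map ((*) c) p"

lemma lookup_scale [simp]: "Poly_Mapping.lookup (scale c p) w = c * Poly_Mapping.lookup p w"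
  by (simp add: scale_def Poly_Mapping.map.rep_eq when_def)

global_interpretation nc: vector_space scale
  by standard (auto intro!: poly_mapping_eqI simp: lookup_add algebra_simps)

definition Ass :: "'x set \<Rightarrow> nat \<Rightarrow> ('x, 'k::field) ncpoly set" where
  "Ass X k = {p. \<forall>w \<in> Poly_Mapping.keys p. set (letters w) \<subseteq> X \<and> length (letters w) = k}"

definition lie_subalgebra :: "('x, 'k::field) ncpoly set \<Rightarrow> bool" where
  "lie_subalgebra L \<longleftrightarrow> nc.subspace L \<and> (\<forall>p\<in>L. \<forall>q\<in>L. p * q - q * p \<in> L)"

definition free_Lie :: "'x set \<Rightarrow> ('x, 'k::field) ncpoly set" where
  "free_Lie X = lie_subalgebra hull (gen ` X)"

definition Lie :: "'x set \<Rightarrow> nat \<Rightarrow> ('x, 'k::field) ncpoly set" where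
  "Lie X k = free_Lie X \<inter> Ass X k"

definition pairing :: "('x, 'k::field) ncpoly \<Rightarrow> ('x, 'k) ncpoly \<Rightarrow> 'k" where
  "pairing p q = (\<Sum>u\<in>Poly_Mapping.keys p. \<Sum>v\<in>Poly_Mapping.keys q.
     Poly_Mapping.lookup p u * Poly_Mapping.lookup q v * (if u = v then 1 else 0))"

text \<open>
  A rearrangement \<open>(k\<^sub>0, \<dots>, k\<^bsub>r+s-1\<^esub>)\<close> of \<open>(0, \<dots>, r+s-1)\<close> is encoded as the permutation \<open>\<sigma>\<close> with
  \<open>\<sigma> i = k\<^sub>i\<close>. Thus \<open>inv \<sigma> j\<close> is the position at which \<open>j\<close> appears, and \<open>0, \<dots>, r-1\<close> appear in their
  original order iff \<open>inv \<sigma>\<close> is increasing on \<open>{..<r}\<close>.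
\<close>

definition shuffle_perms :: "nat \<Rightarrow> nat \<Rightarrow> (nat \<Rightarrow> nat) set" where
  "shuffle_perms r s = {\<sigma>. \<sigma> permutes {..<r+s} \<and>
     strict_mono_on {..<r} (inv \<sigma>) \<and> strict_mono_on {r..<r+s} (inv \<sigma>)}"

definition shuffle_factors ::
  "('x, 'k::field) ncpoly list \<Rightarrow> ('x, 'k) ncpoly list \<Rightarrow> ('x, 'k) ncpoly" where
  "shuffle_factors ps qs = (\<Sum>\<sigma>\<in>shuffle_perms (length ps) (length qs).
     prod_list (map (\<lambda>i. (ps @ qs) ! \<sigma> i) [0..<length ps + length qs]))"

text \<open>
  The bilinear extension of \<^const>\<open>shuffle_factors\<close> from the basis of monomials. Lemma
  \<open>shuffle_prod_list\<close> below confirms that the defining formula then holds for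
  arbitrary factors of degree one, not only for variables.
\<close>

definition shuffle :: "('x, 'k::field) ncpoly \<Rightarrow> ('x, 'k) ncpoly \<Rightarrow> ('x, 'k) ncpoly" where
  "shuffle p q = (\<Sum>u\<in>Poly_Mapping.keys p. \<Sum>v\<in>Poly_Mapping.keys q.
     scale (Poly_Mapping.lookup p u * Poly_Mapping.lookup q v)
       (shuffle_factors (map gen (letters u)) (map gen (letters v))))"

definition Shuf :: "'x set \<Rightarrow> nat \<Rightarrow> ('x, 'k::field) ncpoly set" where
  "Shuf X k = nc.span {shuffle p q | p q k1 k2.
     p \<in> Ass X k1 \<and> q \<in> Ass X k2 \<and> k1 \<ge> 1 \<and> k2 \<ge> 1 \<and> k1 + k2 = k}"

lemma pairing_monom: "pairing (monom xs) (monom ys) = (if xs = ys then 1 else 0)"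
  by (simp add: pairing_def monom_def lookup_single)

lemma prod_list_gen: "prod_list (map gen xs) = (monom xs :: ('x, 'k::field) ncpoly)"
  by (induction xs) (auto simp: monom_def mult_single plus_word_def simp flip: single_one zero_word_def)

lemma sum_keys_superset:
  assumes "finite A" "Poly_Mapping.keys p \<subseteq> A" "\<And>w. Poly_Mapping.lookup p w = 0 \<Longrightarrow> f w = 0"
  shows "sum f (Poly_Mapping.keys p) = sum f A"
  using assms by (intro sum.mono_neutral_left) (auto simp: in_keys_iff)

interpretation ncp: vector_space_pair scale scale ..

lemma nc_linearI:
  assumes "\<And>p q. f (p + q) = f p + f q" "\<And>c p. f (scale c p) = scale c (f p)"
  shows "Vector_Spaces.linear scale scale f"
  using assms by (simp add: Vector_Spaces.linear_iff nc.vector_space_axioms)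

lemma linear_sum_keys:
  fixes g :: "'x word \<Rightarrow> ('x, 'k::field) ncpoly"
  shows "Vector_Spaces.linear scale scale
    (\<lambda>p. \<Sum>u\<in>Poly_Mapping.keys p. scale (Poly_Mapping.lookup p u) (g u))"
    (is "Vector_Spaces.linear _ _ ?F")
proof -
  have sup: "?F p = (\<Sum>u\<in>A. scale (Poly_Mapping.lookup p u) (g u))"
    if "finite A" "Poly_Mapping.keys p \<subseteq> A" for p A
    by (rule sum_keys_superset) (use that in auto)
  have add: "?F (p + q) = ?F p + ?F q" for p q
  proof -
    let ?A = "Poly_Mapping.keys p \<union> Poly_Mapping.keys q"
    show ?thesis
      using sup[of ?A p] sup[of ?A q] sup[of ?A "p + q"] keys_add[of p q]
      by (simp add: lookup_add nc.scale_left_distrib sum.distrib)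
  qed
  have scl: "?F (scale c p) = scale c (?F p)" for c p
  proof -
    have "Poly_Mapping.keys (scale c p) \<subseteq> Poly_Mapping.keys p"
      by (auto simp: in_keys_iff)
    then have "?F (scale c p) =
        (\<Sum>u\<in>Poly_Mapping.keys p. scale (Poly_Mapping.lookup (scale c p) u) (g u))"
      by (intro sup) auto
    then show ?thesis
      by (simp add: nc.scale_sum_right)
  qed
  show ?thesis
    by (rule nc_linearI) (fact add scl)+
qed

lemma ncpoly_expand:
  "(\<Sum>u\<in>Poly_Mapping.keys p. Poly_Mapping.single u (Poly_Mapping.lookup p u)) = p"
  by (rule poly_mapping_eqI) (simp add: lookup_sum lookup_single when_def in_keys_iff)

lemma scale_eq_mult: "scale c p = Poly_Mapping.single 0 c * p"
  by (simp add: scale_def mult_map_scale_conv_mult)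

lemma mult_scale_right: "p * scale c q = scale c (p * q)"
proof -
  have "p * Poly_Mapping.single 0 c = Poly_Mapping.single 0 c * p"
  proof -
    let ?p = "\<Sum>u\<in>Poly_Mapping.keys p. Poly_Mapping.single u (Poly_Mapping.lookup p u)"
    have "?p * Poly_Mapping.single 0 c = Poly_Mapping.single 0 c * ?p"
      by (simp only: sum_distrib_left sum_distrib_right mult_single add_0_left add_0_right mult.commute)
    then show ?thesis
      by (simp only: ncpoly_expand)
  qed
  then show ?thesis
    by (metis scale_eq_mult mult.assoc)
qed

lemma mult_scale_left: "scale c p * q = scale c (p * q)"
  by (simp add: scale_eq_mult mult.assoc)

lemma linear_mult_both: "Vector_Spaces.linear scale scale (\<lambda>p. a * (p * b))"
  by (rule nc_linearI) (simp_all add: distrib_left distrib_right mult_scale_left mult_scale_right)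

lemma linear_prod_list_nth:
  assumes "distinct ns" "length us \<in> set ns"
  shows "Vector_Spaces.linear scale scale (\<lambda>p. prod_list (map ((!) (us @ p # vs)) ns))"
proof -
  obtain js ks where ns: "ns = js @ length us # ks"
    using assms(2) by (meson split_list)
  have *: "(us @ p # vs) ! i = (us @ 0 # vs) ! i" if "i \<noteq> length us" for p i
    using that by (auto simp: nth_append nth_Cons')
  have map: "map ((!) (us @ p # vs)) js = map ((!) (us @ 0 # vs)) js"
    "map ((!) (us @ p # vs)) ks = map ((!) (us @ 0 # vs)) ks" for p
    using assms(1) unfolding ns by (auto intro!: *)
  have "(\<lambda>p. prod_list (map ((!) (us @ p # vs)) ns)) =
      (\<lambda>p. prod_list (map ((!) (us @ 0 # vs)) js) * (p * prod_list (map ((!) (us @ 0 # vs)) ks)))"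
    (is "?F = ?G")
  proof
    show "?F p = ?G p" for p
      unfolding ns by (simp add: map[of p])
  qed
  then show ?thesis
    using linear_mult_both by simp
qed

lemma linear_shuffle_sum:
  assumes "r + s = Suc (length us + length vs)"
  shows "Vector_Spaces.linear scale scale (\<lambda>p. \<Sum>\<sigma>\<in>shuffle_perms r s.
    prod_list (map (\<lambda>i. (us @ p # vs) ! \<sigma> i) [0..<r + s]))"
proof (rule ncp.linear_compose_sum, intro ballI)
  fix \<sigma> assume "\<sigma> \<in> shuffle_perms r s"
  then have \<sigma>: "\<sigma> permutes {..<r + s}"
    by (simp add: shuffle_perms_def)
  have "distinct (map \<sigma> [0..<r + s])"
    using permutes_inj_on[OF \<sigma>] by (simp add: distinct_map)
  moreover have "set (map \<sigma> [0..<r + s]) = {..<r + s}"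
    using permutes_image[OF \<sigma>] by (simp add: atLeast0LessThan)
  then have "length us \<in> set (map \<sigma> [0..<r + s])"
    using assms by simp
  ultimately show "Vector_Spaces.linear scale scale
      (\<lambda>p. prod_list (map (\<lambda>i. (us @ p # vs) ! \<sigma> i) [0..<r + s]))"
    using linear_prod_list_nth[of "map \<sigma> [0..<r + s]" us vs] by (simp add: comp_def)
qed

lemma linear_shuffle_factors:
  "Vector_Spaces.linear scale scale (\<lambda>p. shuffle_factors (us @ p # vs) qs)"
  "Vector_Spaces.linear scale scale (\<lambda>p. shuffle_factors qs (us @ p # vs))"
  using linear_shuffle_sum[of "Suc (length us + length vs)" "length qs" us "vs @ qs"]
    linear_shuffle_sum[of "length qs" "Suc (length us + length vs)" "qs @ us" vs]
  by (simp_all add: shuffle_factors_def)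

lemma linear_shuffle:
  "Vector_Spaces.linear scale scale (\<lambda>p. shuffle p q)"
  "Vector_Spaces.linear scale scale (\<lambda>p. shuffle q p)"
proof -
  show "Vector_Spaces.linear scale scale (\<lambda>p. shuffle p q)"
    using linear_sum_keys[of "\<lambda>u. \<Sum>v\<in>Poly_Mapping.keys q. scale (Poly_Mapping.lookup q v)
      (shuffle_factors (map gen (letters u)) (map gen (letters v)))"]
    by (simp add: shuffle_def nc.scale_sum_right)
  show "Vector_Spaces.linear scale scale (\<lambda>p. shuffle q p)"
    using linear_sum_keys[of "\<lambda>v. \<Sum>u\<in>Poly_Mapping.keys q. scale (Poly_Mapping.lookup q u)
      (shuffle_factors (map gen (letters u)) (map gen (letters v)))"]
    unfolding shuffle_def by (subst sum.swap) (simp add: nc.scale_sum_right mult.commute)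
qed

lemma shuffle_monom: "shuffle (monom xs) (monom ys) = shuffle_factors (map gen xs) (map gen ys)"
  by (simp add: shuffle_def monom_def)

lemma linear_eq_on_degree_one:
  assumes f: "Vector_Spaces.linear scale scale f" and g: "Vector_Spaces.linear scale scale g"
    and eq: "\<And>x. f (gen x) = g (gen x)" and p: "p \<in> Ass UNIV 1"
  shows "f p = g p"
proof -
  have "Poly_Mapping.single u (Poly_Mapping.lookup p u) =
      scale (Poly_Mapping.lookup p u) (gen (hd (letters u)))" if "u \<in> Poly_Mapping.keys p" for u
    using p that by (cases u) (auto simp: Ass_def monom_def scale_def length_Suc_conv)
  then have "(\<Sum>u\<in>Poly_Mapping.keys p. scale (Poly_Mapping.lookup p u) (gen (hd (letters u)))) = p"
    using ncpoly_expand[of p] by simp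
  then have "p \<in> nc.span (range gen)"
    by (metis (no_types, lifting) nc.span_base nc.span_scale nc.span_sum rangeI)
  then show ?thesis
    by (rule ncp.linear_eq_on[OF f g]) (use eq in auto)
qed

lemma shuffle_prod_list:
  fixes ps qs :: "('x, 'k::field) ncpoly list"
  assumes "set ps \<subseteq> Ass UNIV 1" "set qs \<subseteq> Ass UNIV 1"
  shows "shuffle (prod_list ps) (prod_list qs) = shuffle_factors ps qs"
proof -
  have lin: "Vector_Spaces.linear scale scale (\<lambda>p. F (a * (p * b)))"
    if "Vector_Spaces.linear scale scale F" for F :: "('x, 'k) ncpoly \<Rightarrow> ('x, 'k) ncpoly" and a b
    using Vector_Spaces.linear_compose[OF linear_mult_both that] by (simp add: comp_def)
  have right: "shuffle (prod_list (map gen xs)) (prod_list (map gen ys @ qs)) =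
      shuffle_factors (map gen xs) (map gen ys @ qs)" if "set qs \<subseteq> Ass UNIV 1" for xs ys :: "'x list" and qs :: "('x, 'k) ncpoly list"
    using that
  proof (induction qs arbitrary: ys)
    case Nil
    then show ?case by (simp add: prod_list_gen shuffle_monom)
  next
    case (Cons q qs)
    show ?case
    proof (rule linear_eq_on_degree_one[where p = q])
      show "Vector_Spaces.linear scale scale
          (\<lambda>q. shuffle (prod_list (map gen xs)) (prod_list (map gen ys @ q # qs)))"
        using lin[OF linear_shuffle(2)] by simp
      show "shuffle (prod_list (map gen xs)) (prod_list (map gen ys @ gen x # qs)) =
          shuffle_factors (map gen xs) (map gen ys @ gen x # qs)" for x
        using Cons.IH[of "ys @ [x]"] Cons.prems by simp
    qed (use Cons.prems linear_shuffle_factors in auto)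
  qed
  have "shuffle (prod_list (map gen xs @ ps)) (prod_list qs) =
      shuffle_factors (map gen xs @ ps) qs" if "set ps \<subseteq> Ass UNIV 1" for xs :: "'x list" and ps
    using that
  proof (induction ps arbitrary: xs)
    case Nil
    then show ?case using right[of qs xs "[]"] assms(2) by simp
  next
    case (Cons p ps)
    show ?case
    proof (rule linear_eq_on_degree_one[where p = p])
      show "Vector_Spaces.linear scale scale
          (\<lambda>p. shuffle (prod_list (map gen xs @ p # ps)) (prod_list qs))"
        using lin[OF linear_shuffle(1)] by simp
      show "shuffle (prod_list (map gen xs @ gen x # ps)) (prod_list qs) =
          shuffle_factors (map gen xs @ gen x # ps) qs" for x
        using Cons.IH[of "xs @ [x]"] Cons.prems by simp
    qed (use Cons.prems linear_shuffle_factors in auto)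
  qed
  from this[of ps "[]"] show ?thesis using assms(1) by simp
qed

end

theory Submission
  imports Defs
begin

text \<open>
  Lie elements are primitive for the coproduct dual to the shuffle product, hence orthogonal to
  proper shuffles. Conversely, let \<open>D\<close> be the right-normed bracketing
  \<open>x\<^sub>1 \<dots> x\<^sub>k \<mapsto> [x\<^sub>1, [x\<^sub>2, \<dots>]]\<close> and \<open>D'\<close> its adjoint. For every word \<open>w\<close> of length \<open>k\<close>, the
  difference \<open>k w - D' w\<close> is a sum of proper shuffles, so every vector orthogonal to the image of \<open>D\<close>
  lies in \<open>Shuf X k\<close>. As \<open>D\<close> has integer coefficients and the form is positive definite on
  polynomials with rational coefficients, every monomial has an orthogonal projection to the span
  of the image of \<open>D\<close>, which is contained in \<open>Lie X k\<close>. So the two spaces span \<open>Ass X k\<close>, and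
  nondegeneracy of the form makes their intersection trivial.
\<close>

subsection \<open>Shuffle permutations\<close>

definition skip :: "nat \<Rightarrow> nat \<Rightarrow> nat" where
  "skip m j = (if j < m then j else Suc j)"

text \<open>In one-line notation, \<open>m\<close> is put in front of \<open>\<tau>\<close> and the
  old values are relabelled around it. Choosing the first letter of a shuffle becomes choosing
  \<open>m\<close>.\<close>

definition prepend_perm :: "nat \<Rightarrow> (nat \<Rightarrow> nat) \<Rightarrow> nat \<Rightarrow> nat" where
  "prepend_perm m \<tau> = case_nat m (\<lambda>i. skip m (\<tau> i))"

lemma prepend_perm_simps [simp]:
  "prepend_perm m \<tau> 0 = m" "prepend_perm m \<tau> (Suc i) = skip m (\<tau> i)"
  by (simp_all add: prepend_perm_def)

lemma skip_eq_iff [simp]: "skip m i = skip m j \<longleftrightarrow> i = j"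
  by (auto simp: skip_def)

lemma skip_neq [simp]: "skip m j \<noteq> m" "m \<noteq> skip m j"
  by (auto simp: skip_def)

lemma permutes_prepend_perm:
  assumes "\<tau> permutes {..<n}" "m \<le> n"
  shows "prepend_perm m \<tau> permutes {..<Suc n}"
proof (rule bij_imp_permutes)
  have inj: "inj (prepend_perm m \<tau>)"
  proof (rule injI)
    fix x y assume "prepend_perm m \<tau> x = prepend_perm m \<tau> y"
    then show "x = y"
      using permutes_inj[OF assms(1)] by (cases x; cases y) (auto dest: injD)
  qed
  have "prepend_perm m \<tau> ` {..<Suc n} \<subseteq> {..<Suc n}"
  proof (clarsimp)
    fix i assume "i < Suc n"
    then show "prepend_perm m \<tau> i < Suc n"
      using assms permutes_in_image[OF assms(1)]
      by (cases i) (auto simp: skip_def)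
  qed
  then show "bij_betw (prepend_perm m \<tau>) {..<Suc n} {..<Suc n}"
    unfolding bij_betw_def
    using endo_inj_surj[of "{..<Suc n}"] inj_on_subset[OF inj] by blast
  \<comment> \<open>For \<open>i \<ge> n\<close>, position \<open>Suc i\<close> receives
    \<open>skip m i\<close>, which is \<open>Suc i\<close> because \<open>m \<le> n\<close>.\<close>
  show "prepend_perm m \<tau> i = i" if "i \<notin> {..<Suc n}" for i
    using that assms permutes_not_in[OF assms(1)] by (cases i) (auto simp: skip_def)
qed

lemma inv_prepend_perm:
  assumes "\<tau> permutes {..<n}" "m \<le> n"
  shows "inv (prepend_perm m \<tau>) m = 0"
    "inv (prepend_perm m \<tau>) (skip m j) = Suc (inv \<tau> j)"
  using permutes_inv_eq[OF permutes_prepend_perm[OF assms]] permutes_inverses[OF assms(1)]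
  by simp_all

lemma inj_prepend_perm: "inj (prepend_perm m)"
proof (rule injI)
  fix \<sigma> \<tau> assume *: "prepend_perm m \<sigma> = prepend_perm m \<tau>"
  have "skip m (\<sigma> i) = skip m (\<tau> i)" for i
    using fun_cong[OF *, of "Suc i"] by simp
  then show "\<sigma> = \<tau>" by auto
qed

lemma permutes_Suc_prepend_permE:
  assumes "\<sigma> permutes {..<Suc n}"
  obtains \<tau> where "\<tau> permutes {..<n}" "\<sigma> = prepend_perm (\<sigma> 0) \<tau>"
proof
  define m where "m = \<sigma> 0"
  \<comment> \<open>\<open>\<tau>\<close> is \<open>\<sigma>\<close> without its first entry, with
    the gap left by the value \<open>m\<close> closed.\<close>
  define \<tau> where "\<tau> i = (if \<sigma> (Suc i) < m then \<sigma> (Suc i) else \<sigma> (Suc i) - 1)" for i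
  have m: "m \<le> n"
    using permutes_in_image[OF assms, of 0] by (simp add: m_def)
  have ne: "\<sigma> (Suc i) \<noteq> m" for i
    using permutes_inj[OF assms] by (auto simp: m_def dest: injD)
  have skip: "skip m (\<tau> i) = \<sigma> (Suc i)" for i
    using ne[of i] by (auto simp: skip_def \<tau>_def)
  show "\<sigma> = prepend_perm (\<sigma> 0) \<tau>"
  proof
    show "\<sigma> i = prepend_perm (\<sigma> 0) \<tau> i" for i
      using skip by (cases i) (auto simp: m_def)
  qed
  show "\<tau> permutes {..<n}"
  proof (rule bij_imp_permutes)
    have inj: "inj \<tau>"
    proof (rule injI)
      fix x y assume "\<tau> x = \<tau> y"
      then have "\<sigma> (Suc x) = \<sigma> (Suc y)"
        using skip by metis
      then show "x = y"
        using permutes_inj[OF assms] by (auto dest: injD)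
    qed
    have "\<tau> ` {..<n} \<subseteq> {..<n}"
    proof (clarsimp)
      fix i assume "i < n"
      then have "skip m (\<tau> i) < Suc n"
        using permutes_in_image[OF assms, of "Suc i"] skip by simp
      then show "\<tau> i < n"
        using m by (auto simp: skip_def split: if_splits)
    qed
    then show "bij_betw \<tau> {..<n} {..<n}"
      unfolding bij_betw_def
      using endo_inj_surj[of "{..<n}"] inj_on_subset[OF inj] by blast
    show "\<tau> i = i" if "i \<notin> {..<n}" for i
      using that m permutes_not_in[OF assms, of "Suc i"] by (auto simp: \<tau>_def)
  qed
qed

text \<open>If \<open>\<sigma> 0\<close> were any other member of its block, the first member of
  that block would have to stand before position 0.\<close>

lemma shuffle_perms_head:
  assumes "\<sigma> \<in> shuffle_perms (Suc r) (Suc s)"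
  shows "\<sigma> 0 = 0 \<or> \<sigma> 0 = Suc r"
proof (rule ccontr)
  assume *: "\<not> ?thesis"
  have \<sigma>: "\<sigma> permutes {..<Suc r + Suc s}"
    and mono: "strict_mono_on {..<Suc r} (inv \<sigma>)" "strict_mono_on {Suc r..<Suc r + Suc s} (inv \<sigma>)"
    using assms by (simp_all add: shuffle_perms_def)
  have 0: "inv \<sigma> (\<sigma> 0) = 0" "\<sigma> 0 < Suc r + Suc s"
    using permutes_inverses[OF \<sigma>] permutes_in_image[OF \<sigma>, of 0] by auto
  show False
  proof (cases "\<sigma> 0 < Suc r")
    case True
    then have "inv \<sigma> 0 < inv \<sigma> (\<sigma> 0)"
      using * by (intro strict_mono_onD[OF mono(1)]) auto
    then show False using 0 by simp
  next
    case False
    then have "inv \<sigma> (Suc r) < inv \<sigma> (\<sigma> 0)"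
      using * 0(2) by (intro strict_mono_onD[OF mono(2)]) auto
    then show False using 0 by simp
  qed
qed

text \<open>The label 0 at position 0 satisfies its order conditions automatically. All other labels
  and positions move by one, so the remaining conditions are those on \<open>\<tau>\<close>.\<close>

lemma prepend_perm_0_shuffle:
  assumes "\<tau> permutes {..<r + s}"
  shows "prepend_perm 0 \<tau> \<in> shuffle_perms (Suc r) s \<longleftrightarrow> \<tau> \<in> shuffle_perms r s"
proof -
  let ?\<sigma> = "prepend_perm 0 \<tau>"
  have inv: "inv ?\<sigma> 0 = 0" "inv ?\<sigma> (Suc j) = Suc (inv \<tau> j)" for j
    using inv_prepend_perm[OF assms, of 0] by (simp_all add: skip_def)
  have "strict_mono_on {..<Suc r} (inv ?\<sigma>) \<longleftrightarrow> strict_mono_on {..<r} (inv \<tau>)"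
  proof
    assume *: "strict_mono_on {..<Suc r} (inv ?\<sigma>)"
    show "strict_mono_on {..<r} (inv \<tau>)"
    proof (rule strict_mono_onI)
      fix i j assume "i \<in> {..<r}" "j \<in> {..<r}" "i < j"
      then show "inv \<tau> i < inv \<tau> j"
        using strict_mono_onD[OF *, of "Suc i" "Suc j"] by (simp add: inv)
    qed
  next
    assume *: "strict_mono_on {..<r} (inv \<tau>)"
    show "strict_mono_on {..<Suc r} (inv ?\<sigma>)"
    proof (rule strict_mono_onI)
      fix i j assume ij: "i \<in> {..<Suc r}" "j \<in> {..<Suc r}" "i < j"
      then show "inv ?\<sigma> i < inv ?\<sigma> j"
        using strict_mono_onD[OF *, of "i - 1" "j - 1"] by (cases i; cases j) (auto simp: inv)
    qed
  qed
  moreover have "strict_mono_on {Suc r..<Suc r + s} (inv ?\<sigma>) \<longleftrightarrow> strict_mono_on {r..<r + s} (inv \<tau>)"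
  proof
    assume *: "strict_mono_on {Suc r..<Suc r + s} (inv ?\<sigma>)"
    show "strict_mono_on {r..<r + s} (inv \<tau>)"
    proof (rule strict_mono_onI)
      fix i j assume "i \<in> {r..<r + s}" "j \<in> {r..<r + s}" "i < j"
      then show "inv \<tau> i < inv \<tau> j"
        using strict_mono_onD[OF *, of "Suc i" "Suc j"] by (simp add: inv)
    qed
  next
    assume *: "strict_mono_on {r..<r + s} (inv \<tau>)"
    show "strict_mono_on {Suc r..<Suc r + s} (inv ?\<sigma>)"
    proof (rule strict_mono_onI)
      fix i j assume ij: "i \<in> {Suc r..<Suc r + s}" "j \<in> {Suc r..<Suc r + s}" "i < j"
      then show "inv ?\<sigma> i < inv ?\<sigma> j"
        using strict_mono_onD[OF *, of "i - 1" "j - 1"] by (cases i; cases j) (auto simp: inv)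
    qed
  qed
  ultimately show ?thesis
    using assms permutes_prepend_perm[OF assms, of 0] by (simp add: shuffle_perms_def)
qed

text \<open>Here the letter in front is the first of the second block: labels below \<open>r\<close>
  keep their names, later ones move up by one, and every old position moves by one.\<close>

lemma prepend_perm_shuffle:
  assumes "\<tau> permutes {..<r + s}"
  shows "prepend_perm r \<tau> \<in> shuffle_perms r (Suc s) \<longleftrightarrow> \<tau> \<in> shuffle_perms r s"
proof -
  let ?\<sigma> = "prepend_perm r \<tau>"
  have inv: "inv ?\<sigma> r = 0" "j < r \<Longrightarrow> inv ?\<sigma> j = Suc (inv \<tau> j)"
    "r \<le> j \<Longrightarrow> inv ?\<sigma> (Suc j) = Suc (inv \<tau> j)" for j
    using inv_prepend_perm(1)[OF assms, of r] inv_prepend_perm(2)[OF assms, of r j]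
    by (simp_all add: skip_def)
  have "strict_mono_on {..<r} (inv ?\<sigma>) \<longleftrightarrow> strict_mono_on {..<r} (inv \<tau>)"
    by (auto simp add: strict_mono_on_def inv)
  moreover have "strict_mono_on {r..<Suc (r + s)} (inv ?\<sigma>) \<longleftrightarrow> strict_mono_on {r..<r + s} (inv \<tau>)"
  proof
    assume *: "strict_mono_on {r..<Suc (r + s)} (inv ?\<sigma>)"
    show "strict_mono_on {r..<r + s} (inv \<tau>)"
    proof (rule strict_mono_onI)
      fix i j assume "i \<in> {r..<r + s}" "j \<in> {r..<r + s}" "i < j"
      then show "inv \<tau> i < inv \<tau> j"
        using strict_mono_onD[OF *, of "Suc i" "Suc j"] by (simp add: inv)
    qed
  next
    assume *: "strict_mono_on {r..<r + s} (inv \<tau>)"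
    show "strict_mono_on {r..<Suc (r + s)} (inv ?\<sigma>)"
    proof (rule strict_mono_onI)
      fix i j assume ij: "i \<in> {r..<Suc (r + s)}" "j \<in> {r..<Suc (r + s)}" "i < j"
      then obtain j' where j: "j = Suc j'" "r \<le> j'" by (cases j) auto
      show "inv ?\<sigma> i < inv ?\<sigma> j"
      proof (cases "i = r")
        case True
        then show ?thesis using j inv by simp
      next
        case False
        then obtain i' where i: "i = Suc i'" "r \<le> i'" using ij by (cases i) auto
        then show ?thesis
          using strict_mono_onD[OF *, of i' j'] ij j by (simp add: inv)
      qed
    qed
  qed
  ultimately show ?thesis
    using assms permutes_prepend_perm[OF assms, of r] by (simp add: shuffle_perms_def)
qed

text \<open>The first letter of a shuffle is the first letter of one of the two words, and what
  follows is a shuffle of what is left.\<close>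

lemma shuffle_perms_Suc:
  "shuffle_perms (Suc r) (Suc s) =
    prepend_perm 0 ` shuffle_perms r (Suc s) \<union> prepend_perm (Suc r) ` shuffle_perms (Suc r) s"
proof (intro equalityI subsetI)
  fix \<sigma> assume \<sigma>: "\<sigma> \<in> shuffle_perms (Suc r) (Suc s)"
  then have "\<sigma> permutes {..<Suc (Suc (r + s))}"
    by (simp add: shuffle_perms_def)
  then obtain \<tau> where \<tau>: "\<tau> permutes {..<Suc (r + s)}" "\<sigma> = prepend_perm (\<sigma> 0) \<tau>"
    by (rule permutes_Suc_prepend_permE)
  show "\<sigma> \<in> prepend_perm 0 ` shuffle_perms r (Suc s) \<union> prepend_perm (Suc r) ` shuffle_perms (Suc r) s"
    using shuffle_perms_head[OF \<sigma>]
      prepend_perm_0_shuffle[of \<tau> r "Suc s"] prepend_perm_shuffle[of \<tau> "Suc r" s] \<sigma> \<tau>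
    by auto
next
  fix \<sigma> assume "\<sigma> \<in> prepend_perm 0 ` shuffle_perms r (Suc s) \<union>
    prepend_perm (Suc r) ` shuffle_perms (Suc r) s"
  then show "\<sigma> \<in> shuffle_perms (Suc r) (Suc s)"
    using prepend_perm_0_shuffle[of _ r "Suc s"] prepend_perm_shuffle[of _ "Suc r" s]
    by (auto simp: shuffle_perms_def)
qed

lemma finite_shuffle_perms [simp]: "finite (shuffle_perms r s)"
  by (rule finite_subset[OF _ finite_permutations[of "{..<r + s}"]]) (auto simp: shuffle_perms_def)

text \<open>A strictly increasing \<open>inv \<sigma>\<close> satisfies
  \<open>i \<le> inv \<sigma> i\<close>, and a permutation of an initial segment with this property
  is the identity.\<close>

lemma strict_mono_permutes_lessThan:
  fixes \<sigma> :: "nat \<Rightarrow> nat"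
  assumes "\<sigma> permutes {..<n}" "strict_mono_on {..<n} (inv \<sigma>)"
  shows "\<sigma> = id"
proof -
  let ?\<tau> = "inv \<sigma>"
  have \<tau>: "?\<tau> permutes {..<n}"
    by (rule permutes_inv[OF assms(1)])
  have "i \<le> ?\<tau> i" if "i < n" for i
    using that
  proof (induction i)
    case (Suc i)
    then show ?case
      using strict_mono_onD[OF assms(2), of i "Suc i"] by simp
  qed simp
  then have "i \<le> ?\<tau> i" for i
    using permutes_not_in[OF \<tau>, of i] by (cases "i < n") auto
  then have "?\<tau> = id"
    using \<tau> permutes_natset_ge[of ?\<tau> "{..<n}"] by auto
  then show ?thesis
    by (metis assms(1) inv_id permutes_inv_inv)
qed

lemma shuffle_perms_0: "shuffle_perms 0 s = {id}" "shuffle_perms r 0 = {id}"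
  using strict_mono_permutes_lessThan
  by (auto simp: shuffle_perms_def permutes_id strict_mono_on_def atLeast0LessThan)

section \<open>The recursion for shuffles of monomials\<close>

lemma shuffle_monom_eq:
  fixes u v :: "'x list"
  shows "shuffle (monom u) (monom v) =
    (\<Sum>\<sigma>\<in>shuffle_perms (length u) (length v).
      (monom (map (\<lambda>i. (u @ v) ! \<sigma> i) [0..<length u + length v]) :: ('x, 'k::field) ncpoly))"
proof -
  have "prod_list (map (\<lambda>i. (map gen u @ map gen v) ! \<sigma> i) [0..<length u + length v]) =
      (monom (map (\<lambda>i. (u @ v) ! \<sigma> i) [0..<length u + length v]) :: ('x, 'k) ncpoly)"
    if \<sigma>: "\<sigma> \<in> shuffle_perms (length u) (length v)" for \<sigma>
  proof -
    \<comment> \<open>Mapping \<open>gen\<close> commutes with \<open>nth\<close> for indices in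
      range.\<close>
    have "\<sigma> i < length (u @ v)" if "i < length u + length v" for i
      using \<sigma> that permutes_in_image[of \<sigma> "{..<length u + length v}" i]
      by (auto simp: shuffle_perms_def)
    then have "map (\<lambda>i. (map gen u @ map gen v) ! \<sigma> i) [0..<length u + length v] =
        (map gen (map (\<lambda>i. (u @ v) ! \<sigma> i) [0..<length u + length v]) :: ('x, 'k) ncpoly list)"
      by (simp flip: map_append)
    then show ?thesis
      by (simp only: prod_list_gen)
  qed
  then show ?thesis
    by (simp add: shuffle_monom shuffle_factors_def cong: sum.cong)
qed

lemma gen_mult_monom: "gen x * monom u = (monom (x # u) :: ('x, 'k::field) ncpoly)"
  by (simp add: monom_def mult_single plus_word_def)

lemma shuffle_monom_Nil [simp]:
  "shuffle (monom []) (monom v) = (monom v :: ('x, 'k::field) ncpoly)"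
  "shuffle (monom u) (monom []) = (monom u :: ('x, 'k) ncpoly)"
  by (simp_all add: shuffle_monom_eq shuffle_perms_0 map_nth)

text \<open>Splitting the permutations by their first value gives the usual recursion for the
  shuffle product. Later arguments use this rule and the rules for the empty word instead of
  permutations.\<close>

lemma shuffle_monom_Cons:
  fixes u v :: "'x list"
  shows "shuffle (monom (x # u)) (monom (y # v)) =
    gen x * shuffle (monom u) (monom (y # v)) + gen y * shuffle (monom (x # u)) (monom v :: ('x, 'k::field) ncpoly)"
    (is "?L = ?R1 + ?R2")
proof -
  let ?n = "Suc (length u + length v)"
  let ?h = "\<lambda>\<sigma>. monom (map (\<lambda>i. (x # u @ y # v) ! \<sigma> i) [0..<Suc ?n]) :: ('x, 'k) ncpoly"
  let ?A = "shuffle_perms (length u) (Suc (length v))"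
  let ?B = "shuffle_perms (Suc (length u)) (length v)"
  have upt: "[0..<Suc n] = 0 # map Suc [0..<n]" for n
    by (metis map_Suc_upt upt_conv_Cons zero_less_Suc)
  have "?L = (\<Sum>\<sigma>\<in>prepend_perm 0 ` ?A \<union> prepend_perm (Suc (length u)) ` ?B. ?h \<sigma>)"
    by (simp add: shuffle_monom_eq shuffle_perms_Suc del: upt_Suc)
  also have "\<dots> = (\<Sum>\<sigma>\<in>prepend_perm 0 ` ?A. ?h \<sigma>) + (\<Sum>\<sigma>\<in>prepend_perm (Suc (length u)) ` ?B. ?h \<sigma>)"
    \<comment> \<open>The value at 0 tells the two images apart: \<open>0\<close> against
      \<open>Suc (length u)\<close>.\<close>
    by (rule sum.union_disjoint) (auto dest!: fun_cong[of _ _ 0])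
  also have "\<dots> = (\<Sum>\<tau>\<in>?A. ?h (prepend_perm 0 \<tau>)) + (\<Sum>\<tau>\<in>?B. ?h (prepend_perm (Suc (length u)) \<tau>))"
    using inj_on_subset[OF inj_prepend_perm] by (simp add: sum.reindex comp_def del: upt_Suc)
  also have "(\<Sum>\<tau>\<in>?A. ?h (prepend_perm 0 \<tau>)) = ?R1"
    by (simp add: shuffle_monom_eq sum_distrib_left gen_mult_monom upt comp_def skip_def
        del: upt_Suc)
  also have "(\<Sum>\<tau>\<in>?B. ?h (prepend_perm (Suc (length u)) \<tau>)) = ?R2"
  proof -
    \<comment> \<open>Index \<open>Suc (length u)\<close> is that of \<open>y\<close>, so skipping
      it reads the list with \<open>y\<close> deleted.\<close>
    have "(x # u @ y # v) ! skip (Suc (length u)) j = ((x # u) @ v) ! j" for j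
      by (auto simp: skip_def nth_Cons' nth_append)
    moreover have "(x # u @ y # v) ! Suc (length u) = y"
      by simp
    ultimately show ?thesis
      by (simp add: shuffle_monom_eq sum_distrib_left gen_mult_monom upt comp_def
          del: upt_Suc nth_Cons_Suc)
  qed
  finally show ?thesis .
qed

subsection \<open>Monomials and words\<close>

lemma ncpoly_expand_monom:
  "(\<Sum>w\<in>Poly_Mapping.keys p. scale (Poly_Mapping.lookup p w) (monom (letters w))) = p"
  using ncpoly_expand[of p] by (simp add: monom_def scale_def)

lemma in_span_monom_keys: "p \<in> nc.span ((\<lambda>w. monom (letters w)) ` Poly_Mapping.keys p)"
  by (metis (no_types, lifting) ncpoly_expand_monom imageI nc.span_base nc.span_scale nc.span_sum)

text \<open>Every polynomial is a linear combination of monomials, so identities linear in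
  \<open>p\<close> need only be checked on monomials.\<close>

lemma ncpoly_induct [case_names zero add]:
  assumes "P 0" "\<And>c w p. P p \<Longrightarrow> P (scale c (monom w) + p)"
  shows "P p"
  using in_span_monom_keys by (rule nc.span_induct_alt) (use assms in auto)

lemma lookup_monom: "Poly_Mapping.lookup (monom w) v = (if v = Word w then 1 else 0)"
  by (auto simp: monom_def lookup_single when_def)

lemma monom_Nil: "monom [] = 1"
  by (simp add: monom_def flip: zero_word_def)

lemma monom_mult_monom: "monom u * monom v = (monom (u @ v) :: ('x, 'k::field) ncpoly)"
  by (simp add: monom_def mult_single plus_word_def)

lemma lookup_gen_mult:
  "Poly_Mapping.lookup (gen x * p) (Word w) =
    (if w \<noteq> [] \<and> hd w = x then Poly_Mapping.lookup p (Word (tl w)) else (0 :: 'k::field))"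
proof (induction p rule: ncpoly_induct)
  case (add c v p)
  then show ?case
    by (cases w) (auto simp: distrib_left mult_scale_right lookup_add gen_mult_monom lookup_monom)
qed simp

lemma lookup_mult_gen:
  "Poly_Mapping.lookup (p * gen x) (Word w) =
    (if w \<noteq> [] \<and> last w = x then Poly_Mapping.lookup p (Word (butlast w)) else (0 :: 'k::field))"
proof (induction p rule: ncpoly_induct)
  case (add c v p)
  then show ?case
    by (cases w rule: rev_cases)
      (auto simp: distrib_right mult_scale_left lookup_add monom_mult_monom lookup_monom)
qed simp

lemmas shuffle_linear_simps =
  ncp.linear_add[OF linear_shuffle(1)] ncp.linear_add[OF linear_shuffle(2)]
  ncp.linear_scale[OF linear_shuffle(1)] ncp.linear_scale[OF linear_shuffle(2)]
  ncp.linear_0[OF linear_shuffle(1)] ncp.linear_0[OF linear_shuffle(2)]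
  ncp.linear_diff[OF linear_shuffle(1)] ncp.linear_diff[OF linear_shuffle(2)]

lemma shuffle_1 [simp]: "shuffle 1 p = p" "shuffle p 1 = p"
proof -
  show "shuffle 1 p = p"
    by (induction p rule: ncpoly_induct) (simp_all add: shuffle_linear_simps flip: monom_Nil)
  show "shuffle p 1 = p"
    by (induction p rule: ncpoly_induct) (simp_all add: shuffle_linear_simps flip: monom_Nil)
qed

text \<open>The recursion extended bilinearly, as the values of \<open>dynkin_adj\<close> need not
  be monomials. It is proved in \<open>q\<close> for a monomial first factor, and then in
  \<open>p\<close>.\<close>

lemma shuffle_gen_mult:
  "shuffle (gen x * p) (gen y * q) = gen x * shuffle p (gen y * q) + gen y * shuffle (gen x * p) q"
proof (induction p rule: ncpoly_induct)
  case (add c u p)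
  have "shuffle (gen x * monom u) (gen y * q) =
      gen x * shuffle (monom u) (gen y * q) + gen y * shuffle (gen x * monom u) q"
  proof (induction q rule: ncpoly_induct)
    case (add d v q)
    then show ?case
      by (simp add: shuffle_linear_simps distrib_left mult_scale_right gen_mult_monom
          shuffle_monom_Cons nc.scale_right_distrib)
  qed (simp add: shuffle_linear_simps)
  then show ?case
    using add by (simp add: shuffle_linear_simps distrib_left mult_scale_right nc.scale_right_distrib)
qed (simp add: shuffle_linear_simps)

subsection \<open>The bilinear form\<close>

text \<open>Orthonormality of the words collapses the double sum to its diagonal. An arbitrary
  finite \<open>A\<close> gives several pairings a common index set.\<close>

lemma pairing_eq_sum:
  assumes "finite A" "Poly_Mapping.keys p \<subseteq> A"
  shows "pairing p q = (\<Sum>w\<in>A. Poly_Mapping.lookup p w * Poly_Mapping.lookup q w)"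
proof -
  have "pairing p q = (\<Sum>u\<in>Poly_Mapping.keys p. \<Sum>v\<in>Poly_Mapping.keys q.
      if u = v then Poly_Mapping.lookup p v * Poly_Mapping.lookup q v else 0)"
    unfolding pairing_def by (intro sum.cong refl) auto
  also have "\<dots> = (\<Sum>w\<in>Poly_Mapping.keys p. Poly_Mapping.lookup p w * Poly_Mapping.lookup q w)"
    by (intro sum.cong refl) (auto simp: in_keys_iff)
  also have "\<dots> = (\<Sum>w\<in>A. Poly_Mapping.lookup p w * Poly_Mapping.lookup q w)"
    by (rule sum_keys_superset) (use assms in auto)
  finally show ?thesis .
qed

lemma pairing_commute: "pairing p q = pairing q p"
proof -
  let ?A = "Poly_Mapping.keys p \<union> Poly_Mapping.keys q"
  show ?thesis
    using pairing_eq_sum[of ?A p q] pairing_eq_sum[of ?A q p] by (simp add: mult.commute)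
qed

lemma pairing_add_left: "pairing (p + q) r = pairing p r + pairing q r"
proof -
  let ?A = "Poly_Mapping.keys p \<union> Poly_Mapping.keys q"
  show ?thesis
    using pairing_eq_sum[of ?A p r] pairing_eq_sum[of ?A q r] pairing_eq_sum[of ?A "p + q" r]
      keys_add[of p q]
    by (simp add: lookup_add distrib_right sum.distrib)
qed

lemma pairing_scale_left: "pairing (scale c p) q = c * pairing p q"
proof -
  have "Poly_Mapping.keys (scale c p) \<subseteq> Poly_Mapping.keys p"
    by (auto simp: in_keys_iff)
  then show ?thesis
    using pairing_eq_sum[of "Poly_Mapping.keys p" p q]
      pairing_eq_sum[of "Poly_Mapping.keys p" "scale c p" q]
    by (simp add: sum_distrib_left mult.assoc)
qed

lemma pairing_0_left: "pairing 0 q = 0"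
  by (simp add: pairing_def)

lemma pairing_diff_left: "pairing (p - q) r = pairing p r - pairing q r"
  using pairing_add_left[of "p - q" q r] by simp

lemmas pairing_left_simps =
  pairing_add_left pairing_scale_left pairing_0_left pairing_diff_left

lemma pairing_right_simps:
  "pairing r (p + q) = pairing r p + pairing r q"
  "pairing r (scale c p) = c * pairing r p"
  "pairing r 0 = 0"
  "pairing r (p - q) = pairing r p - pairing r q"
  using pairing_left_simps pairing_commute[of r] by simp_all

subsection \<open>The coproduct dual to the shuffle product\<close>

text \<open>The coefficient at \<open>u \<otimes> v\<close> of the coproduct adjoint to the shuffle
  product. Working with coefficients avoids a tensor product.\<close>

definition coprod :: "('x, 'k::field) ncpoly \<Rightarrow> 'x list \<Rightarrow> 'x list \<Rightarrow> 'k" where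
  "coprod p u v = pairing (shuffle (monom u) (monom v)) p"

lemma pairing_monom_left: "pairing (monom u) p = (Poly_Mapping.lookup p (Word u) :: 'k::field)"
  using pairing_eq_sum[of "{Word u}" "monom u" p] by (simp add: monom_def)

lemma coprod_linear_simps:
  "coprod (p + q) u v = coprod p u v + coprod q u v"
  "coprod (scale c p) u v = c * coprod p u v"
  "coprod 0 u v = 0"
  "coprod (p - q) u v = coprod p u v - coprod q u v"
  by (simp_all add: coprod_def pairing_right_simps)

lemma coprod_Nil_left: "coprod p [] v = Poly_Mapping.lookup p (Word v)"
  by (simp add: coprod_def pairing_monom_left)

lemma pairing_gen_mult:
  "pairing (gen y * s) (gen x * p) = (if x = y then pairing s p else (0 :: 'k::field))"
proof (induction s rule: ncpoly_induct)
  case (add c u s)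
  then show ?case
    by (auto simp: pairing_left_simps distrib_left mult_scale_right gen_mult_monom
        pairing_monom_left lookup_gen_mult)
qed (simp add: pairing_left_simps)

lemma pairing_gen_mult_1: "pairing (gen x * p) 1 = (0 :: 'k::field)"
  using pairing_monom_left[of "[]" "gen x * p"]
  by (simp add: pairing_commute monom_Nil lookup_gen_mult)

lemma coprod_1: "coprod 1 u v = (if u = [] \<and> v = [] then 1 else (0 :: 'k::field))"
proof (cases "u = [] \<or> v = []")
  case True
  then show ?thesis
    by (auto simp: coprod_def pairing_monom_left lookup_monom simp flip: monom_Nil)
next
  case False
  then show ?thesis
    by (auto simp: neq_Nil_conv coprod_def shuffle_monom_Cons pairing_left_simps pairing_gen_mult_1)
qed

text \<open>The coproduct of \<open>gen x\<close> is
  \<open>gen x \<otimes> 1 + 1 \<otimes> gen x\<close>, so the letter is stripped either from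
  \<open>u\<close> or from \<open>v\<close>. This is dual to
  \<open>shuffle_monom_Cons\<close>.\<close>

lemma coprod_gen_mult:
  "coprod (gen x * p) u v =
    (if u \<noteq> [] \<and> hd u = x then coprod p (tl u) v else 0) +
    (if v \<noteq> [] \<and> hd v = x then coprod p u (tl v) else (0 :: 'k::field))"
proof (cases "u = [] \<or> v = []")
  case True
  then show ?thesis
    by (auto simp: coprod_def pairing_monom_left lookup_gen_mult)
next
  case False
  then show ?thesis
    by (auto simp: neq_Nil_conv coprod_def shuffle_monom_Cons pairing_left_simps pairing_gen_mult)
qed

text \<open>The coproduct is multiplicative for concatenation: a coefficient of a product in the
  tensor square sums over all ways of cutting both words. By linearity \<open>p\<close> may be taken
  to be a monomial, whose letters are peeled off by \<open>coprod_gen_mult\<close>.\<close>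

lemma coprod_mult:
  "coprod (p * q) u v = (\<Sum>i\<le>length u. \<Sum>j\<le>length v.
    coprod p (take i u) (take j v) * coprod q (drop i u) (drop j v) :: 'k::field)"
proof (induction p rule: ncpoly_induct)
  case zero
  then show ?case by (simp add: coprod_linear_simps)
next
  case (add c w p)
  have "coprod (monom w * q) u v = (\<Sum>i\<le>length u. \<Sum>j\<le>length v.
    coprod (monom w) (take i u) (take j v) * coprod q (drop i u) (drop j v))"
  proof (induction w arbitrary: u v)
    case Nil
    have "(\<Sum>i\<le>length u. \<Sum>j\<le>length v.
          coprod (monom []) (take i u) (take j v) * coprod q (drop i u) (drop j v)) =
        (\<Sum>i\<le>length u. \<Sum>j\<le>length v. if i = 0 then if j = 0 then coprod q u v else 0 else 0)"
      by (intro sum.cong refl) (auto simp: monom_Nil coprod_1)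
    also have "\<dots> = (\<Sum>i\<le>length u. if i = 0 then coprod q u v else 0)"
      by (intro sum.cong refl) auto
    finally show ?case
      by (simp add: monom_Nil)
  next
    case (Cons x w)
    let ?S = "\<lambda>u v. \<Sum>i\<le>length u. \<Sum>j\<le>length v.
      coprod (monom w) (take i u) (take j v) * coprod q (drop i u) (drop j v)"
    \<comment> \<open>The summand at \<open>i = 0\<close> vanishes, since \<open>take 0 u\<close> is
      empty; shifting \<open>i\<close> leaves the sum for \<open>tl u\<close>.\<close>
    have left: "(\<Sum>i\<le>length u. \<Sum>j\<le>length v.
        (if take i u \<noteq> [] \<and> hd (take i u) = x then coprod (monom w) (tl (take i u)) (take j v) else 0) *
          coprod q (drop i u) (drop j v)) = (if u \<noteq> [] \<and> hd u = x then ?S (tl u) v else 0)" for u v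
    proof (cases u)
      case (Cons y u')
      show ?thesis
        by (simp add: Cons sum.atMost_Suc_shift del: sum.atMost_Suc)
    qed simp
    have right: "(\<Sum>i\<le>length u. \<Sum>j\<le>length v.
        (if take j v \<noteq> [] \<and> hd (take j v) = x then coprod (monom w) (take i u) (tl (take j v)) else 0) *
          coprod q (drop i u) (drop j v)) = (if v \<noteq> [] \<and> hd v = x then ?S u (tl v) else 0)" for u v
    proof (cases v)
      case (Cons y v')
      show ?thesis
        by (simp add: Cons sum.atMost_Suc_shift del: sum.atMost_Suc)
    qed simp
    have "coprod (monom (x # w) * q) u v =
        (if u \<noteq> [] \<and> hd u = x then ?S (tl u) v else 0) + (if v \<noteq> [] \<and> hd v = x then ?S u (tl v) else 0)"
      unfolding gen_mult_monom[of x w, symmetric] mult.assoc coprod_gen_mult Cons.IH ..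
    also have "\<dots> = (\<Sum>i\<le>length u. \<Sum>j\<le>length v.
        coprod (monom (x # w)) (take i u) (take j v) * coprod q (drop i u) (drop j v))"
      unfolding left[symmetric] right[symmetric]
      unfolding gen_mult_monom[of x w, symmetric] coprod_gen_mult distrib_right sum.distrib ..
    finally show ?case .
  qed
  then show ?case
    using add by (simp add: distrib_right mult_scale_left coprod_linear_simps sum.distrib
        sum_distrib_left mult.assoc)
qed

corollary lookup_mult_splits:
  "Poly_Mapping.lookup (p * q) (Word v) =
    (\<Sum>j\<le>length v. Poly_Mapping.lookup p (Word (take j v)) * Poly_Mapping.lookup q (Word (drop j v)) :: 'k::field)"
  using coprod_mult[of p q "[]" v] by (simp add: coprod_Nil_left)

section \<open>Primitive elements and orthogonality to shuffles\<close>

text \<open>In tensor notation, the coproduct of \<open>p\<close> is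
  \<open>p \<otimes> 1 + 1 \<otimes> p\<close>. For \<open>u\<close> and \<open>v\<close> both empty
  this forces the constant term to be 0.\<close>

definition primitive :: "('x, 'k::field) ncpoly \<Rightarrow> bool" where
  "primitive p \<longleftrightarrow> (\<forall>u v. coprod p u v =
    (if u = [] then Poly_Mapping.lookup p (Word v) else 0) +
    (if v = [] then Poly_Mapping.lookup p (Word u) else 0))"

lemma primitive_coprod:
  assumes "primitive p"
  shows "coprod p u v =
    (if u = [] then Poly_Mapping.lookup p (Word v) else 0) +
    (if v = [] then Poly_Mapping.lookup p (Word u) else 0)"
  using assms unfolding primitive_def by blast

lemma primitive_gen: "primitive (gen x :: ('x, 'k::field) ncpoly)"
proof -
  have "coprod (gen x * 1) u v =
    (if u = [] then Poly_Mapping.lookup (gen x) (Word v) else 0) +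
    (if v = [] then Poly_Mapping.lookup (gen x) (Word u) else (0 :: 'k))" for u v :: "'x list"
    unfolding coprod_gen_mult coprod_1 by (cases u; cases v) (auto simp: lookup_monom)
  then show ?thesis unfolding primitive_def by simp
qed

text \<open>Expands \<open>(p \<otimes> 1 + 1 \<otimes> p) (q \<otimes> 1 + 1 \<otimes> q)\<close>.
  The two mixed terms together are symmetric in \<open>p\<close> and \<open>q\<close>, which is why
  they disappear from the commutator.\<close>

lemma coprod_mult_primitive:
  fixes p q :: "('x, 'k::field) ncpoly"
  assumes "primitive p" "primitive q"
  shows "coprod (p * q) u v =
    (if u = [] then Poly_Mapping.lookup (p * q) (Word v) else 0) +
    (if v = [] then Poly_Mapping.lookup (p * q) (Word u) else 0) +
    Poly_Mapping.lookup p (Word v) * Poly_Mapping.lookup q (Word u) +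
    Poly_Mapping.lookup p (Word u) * Poly_Mapping.lookup q (Word v)"
proof -
  let ?p = "\<lambda>w. Poly_Mapping.lookup p (Word w)" and ?q = "\<lambda>w. Poly_Mapping.lookup q (Word w)"
  let ?r = "length u" and ?s = "length v"
  have expand: "((if A then a else 0) + (if B then b else 0)) * ((if C then c else 0) + (if D then d else 0)) =
      (if A then if C then a * c else 0 else 0) + (if B then if D then b * d else 0 else 0) +
      (if A then if D then a * d else 0 else 0) + (if B then if C then b * c else 0 else 0)"
    for A B C D and a b c d :: 'k
    by (simp add: distrib_left distrib_right)
  \<comment> \<open>In these ranges \<open>take i u\<close> is empty exactly for
    \<open>i = 0\<close> and \<open>drop i u\<close> exactly for \<open>i = length u\<close>. The
    conditions become deltas that collapse the four double sums.\<close>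
  have "coprod (p * q) u v = (\<Sum>i\<le>?r. \<Sum>j\<le>?s.
      ((if i = 0 then ?p (take j v) else 0) + (if j = 0 then ?p (take i u) else 0)) *
      ((if i = ?r then ?q (drop j v) else 0) + (if j = ?s then ?q (drop i u) else 0)))"
    unfolding coprod_mult primitive_coprod[OF assms(1)] primitive_coprod[OF assms(2)]
    by (intro sum.cong refl arg_cong2[where f = "(*)"] arg_cong2[where f = "(+)"]) auto
  also have "\<dots> =
      (\<Sum>i\<le>?r. \<Sum>j\<le>?s. if i = 0 then if i = ?r then ?p (take j v) * ?q (drop j v) else 0 else 0) +
      (\<Sum>i\<le>?r. \<Sum>j\<le>?s. if j = 0 then if j = ?s then ?p (take i u) * ?q (drop i u) else 0 else 0) +
      (\<Sum>i\<le>?r. \<Sum>j\<le>?s. if i = 0 then if j = ?s then ?p (take j v) * ?q (drop i u) else 0 else 0) +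
      (\<Sum>i\<le>?r. \<Sum>j\<le>?s. if j = 0 then if i = ?r then ?p (take i u) * ?q (drop j v) else 0 else 0)"
    unfolding sum.distrib[symmetric] by (intro sum.cong refl) (rule expand)
  also have "(\<Sum>i\<le>?r. \<Sum>j\<le>?s. if i = 0 then if i = ?r then ?p (take j v) * ?q (drop j v) else 0 else 0) =
      (\<Sum>i\<le>?r. if i = 0 then if u = [] then Poly_Mapping.lookup (p * q) (Word v) else 0 else 0)"
    by (intro sum.cong refl) (auto simp: lookup_mult_splits)
  also have "(\<Sum>i\<le>?r. \<Sum>j\<le>?s. if j = 0 then if j = ?s then ?p (take i u) * ?q (drop i u) else 0 else 0) =
      (\<Sum>i\<le>?r. if v = [] then ?p (take i u) * ?q (drop i u) else 0)"
    by (intro sum.cong refl) auto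
  also have "\<dots> = (if v = [] then Poly_Mapping.lookup (p * q) (Word u) else 0)"
    by (simp add: lookup_mult_splits)
  also have "(\<Sum>i\<le>?r. \<Sum>j\<le>?s. if i = 0 then if j = ?s then ?p (take j v) * ?q (drop i u) else 0 else 0) =
      (\<Sum>i\<le>?r. if i = 0 then ?p v * ?q u else 0)"
    by (intro sum.cong refl) auto
  also have "(\<Sum>i\<le>?r. \<Sum>j\<le>?s. if j = 0 then if i = ?r then ?p (take i u) * ?q (drop j v) else 0 else 0) =
      (\<Sum>i\<le>?r. if i = ?r then ?p u * ?q v else 0)"
    by (intro sum.cong refl) auto
  finally show ?thesis by simp
qed

lemma lie_subalgebra_primitive: "lie_subalgebra {p :: ('x, 'k::field) ncpoly. primitive p}"
proof -
  have "nc.subspace {p :: ('x, 'k) ncpoly. primitive p}"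
  proof (rule nc.subspaceI; clarify)
    show "primitive (0 :: ('x, 'k) ncpoly)"
      by (simp add: primitive_def coprod_linear_simps)
    show "primitive (p + q)" if "primitive p" "primitive q" for p q :: "('x, 'k) ncpoly"
      unfolding primitive_def coprod_linear_simps lookup_add that[THEN primitive_coprod]
      by simp
    show "primitive (scale c p)" if "primitive p" for c and p :: "('x, 'k) ncpoly"
      unfolding primitive_def coprod_linear_simps lookup_scale that[THEN primitive_coprod]
      by (simp add: distrib_left)
  qed
  moreover have "primitive (p * q - q * p)" if "primitive p" "primitive q" for p q :: "('x, 'k) ncpoly"
    unfolding primitive_def coprod_linear_simps lookup_minus
      coprod_mult_primitive[OF that] coprod_mult_primitive[OF that(2,1)]
    by (simp add: mult.commute)
  ultimately show ?thesis
    by (simp add: lie_subalgebra_def)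
qed

text \<open>The primitive elements form a Lie subalgebra containing the generators, and
  \<open>free_Lie X\<close> is the smallest Lie subalgebra containing \<open>gen\<close> applied to
  \<open>X\<close>.\<close>

lemma free_Lie_primitive: "p \<in> free_Lie X \<Longrightarrow> primitive p"
  unfolding free_Lie_def
  by (erule hull_induct) (auto simp: primitive_gen lie_subalgebra_primitive)

text \<open>Factors of positive degree involve only nonempty words, and at a pair of nonempty words
  the coproduct of a primitive element has coefficient 0.\<close>

lemma pairing_shuffle_primitive:
  fixes p q l :: "('x, 'k::field) ncpoly"
  assumes "primitive l" "p \<in> Ass X i" "q \<in> Ass X j" "i \<ge> 1" "j \<ge> 1"
  shows "pairing (shuffle p q) l = 0"
proof -
  have "pairing (shuffle p (monom v)) l = 0" if "v \<noteq> []" for v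
  proof -
    have "p \<in> nc.span ((\<lambda>w. monom (letters w)) ` Poly_Mapping.keys p)"
      by (rule in_span_monom_keys)
    then show ?thesis
    proof (rule nc.span_induct)
      show "nc.subspace {p. pairing (shuffle p (monom v)) l = 0}"
        by (rule nc.subspaceI) (simp_all add: shuffle_linear_simps pairing_left_simps)
    next
      fix m :: "('x, 'k) ncpoly"
      assume "m \<in> (\<lambda>w. monom (letters w)) ` Poly_Mapping.keys p"
      then obtain u where u: "m = monom u" "u \<noteq> []"
        using assms(2,4) by (fastforce simp: Ass_def)
      then have "coprod l u v = 0"
        using assms(1) that unfolding primitive_def by simp
      then show "pairing (shuffle m (monom v)) l = 0"
        by (simp add: u coprod_def)
    qed
  qed
  note * = this
  have "q \<in> nc.span ((\<lambda>w. monom (letters w)) ` Poly_Mapping.keys q)"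
    by (rule in_span_monom_keys)
  then show ?thesis
  proof (rule nc.span_induct)
    show "nc.subspace {q. pairing (shuffle p q) l = 0}"
      by (rule nc.subspaceI) (simp_all add: shuffle_linear_simps pairing_left_simps)
    show "pairing (shuffle p m) l = 0"
      if "m \<in> (\<lambda>w. monom (letters w)) ` Poly_Mapping.keys q" for m :: "('x, 'k) ncpoly"
    proof -
      obtain v where "m = monom v" "v \<noteq> []"
        using \<open>m \<in> _\<close> assms(3,5) by (fastforce simp: Ass_def)
      then show ?thesis using * by simp
    qed
  qed
qed

lemma pairing_Shuf_Lie:
  fixes s l :: "('x, 'k::field) ncpoly"
  assumes "s \<in> Shuf X k" "l \<in> Lie X k"
  shows "pairing s l = 0"
  using assms(1) unfolding Shuf_def
proof (rule nc.span_induct)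
  show "nc.subspace {s. pairing s l = 0}"
    by (rule nc.subspaceI) (simp_all add: pairing_left_simps)
next
  fix m :: "('x, 'k) ncpoly"
  assume "m \<in> {shuffle p q | p q k1 k2.
    p \<in> Ass X k1 \<and> q \<in> Ass X k2 \<and> k1 \<ge> 1 \<and> k2 \<ge> 1 \<and> k1 + k2 = k}"
  then obtain p q i j where "m = shuffle p q" "p \<in> Ass X i" "q \<in> Ass X j" "i \<ge> 1" "j \<ge> 1"
    by blast
  moreover have "primitive l"
    using assms(2) free_Lie_primitive by (auto simp: Lie_def)
  ultimately show "pairing m l = 0"
    using pairing_shuffle_primitive by blast
qed

subsection \<open>Homogeneous components\<close>

lemma subspace_Ass: "nc.subspace (Ass X k)"
proof (rule nc.subspaceI)
  show "p + q \<in> Ass X k" if "p \<in> Ass X k" "q \<in> Ass X k" for p q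
    using that keys_add[of p q] by (fastforce simp: Ass_def)
qed (auto simp: Ass_def in_keys_iff)

lemma monom_in_Ass: "set w \<subseteq> X \<Longrightarrow> monom w \<in> Ass X (length w)"
  by (simp add: Ass_def monom_def)

lemma mult_in_Ass: "p \<in> Ass X i \<Longrightarrow> q \<in> Ass X j \<Longrightarrow> p * q \<in> Ass X (i + j)"
  using keys_mult[of p q] by (fastforce simp: Ass_def plus_word_def)

lemma gen_mult_in_Ass: "x \<in> X \<Longrightarrow> p \<in> Ass X k \<Longrightarrow> gen x * p \<in> Ass X (Suc k)"
  using mult_in_Ass[of "gen x" X 1 p k] monom_in_Ass[of "[x]" X] by simp

lemma mult_gen_in_Ass: "x \<in> X \<Longrightarrow> p \<in> Ass X k \<Longrightarrow> p * gen x \<in> Ass X (Suc k)"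
  using mult_in_Ass[of p X k "gen x" 1] monom_in_Ass[of "[x]" X] by simp

lemma Ass_span_monom: "p \<in> Ass X k \<Longrightarrow> p \<in> nc.span (monom ` {w. set w \<subseteq> X \<and> length w = k})"
  using in_span_monom_keys[of p]
  by (rule rev_subsetD) (rule nc.span_mono, auto simp: Ass_def)

lemma shuffle_monom_in_Ass:
  assumes "set u \<subseteq> X" "set v \<subseteq> X"
  shows "shuffle (monom u) (monom v) \<in> Ass X (length u + length v)"
  using assms
proof (induction "length u + length v" arbitrary: u v rule: less_induct)
  case less
  show ?case
  proof (cases "u = [] \<or> v = []")
    case True
    then show ?thesis using less.prems monom_in_Ass by auto
  next
    case False
    then obtain x u' y v' where uv: "u = x # u'" "v = y # v'"
      by (auto simp: neq_Nil_conv)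
    show ?thesis
      using less.hyps[of u' v] less.hyps[of u v'] less.prems
      by (auto simp: uv shuffle_monom_Cons intro!: nc.subspace_add[OF subspace_Ass] gen_mult_in_Ass)
  qed
qed

lemma shuffle_in_Ass:
  assumes "p \<in> Ass X i" "q \<in> Ass X j"
  shows "shuffle p q \<in> Ass X (i + j)"
proof -
  have *: "set (letters u) \<subseteq> X \<and> set (letters v) \<subseteq> X \<and> length (letters u) + length (letters v) = i + j"
    if "u \<in> Poly_Mapping.keys p" "v \<in> Poly_Mapping.keys q" for u v
    using assms that by (auto simp: Ass_def)
  have "shuffle_factors (map gen (letters u)) (map gen (letters v)) \<in> Ass X (i + j)"
    if "u \<in> Poly_Mapping.keys p" "v \<in> Poly_Mapping.keys q" for u v
    using shuffle_monom_in_Ass[of "letters u" X "letters v"] *[OF that] by (simp add: shuffle_monom)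
  then show ?thesis
    unfolding shuffle_def
    by (intro nc.subspace_sum[OF subspace_Ass] nc.subspace_scale[OF subspace_Ass])
qed

lemma subspace_Shuf: "nc.subspace (Shuf X k)"
  unfolding Shuf_def by (rule nc.subspace_span)

lemma Shuf_subset_Ass: "Shuf X k \<subseteq> Ass X k"
  unfolding Shuf_def
  by (rule nc.span_minimal) (auto simp: subspace_Ass intro: shuffle_in_Ass)

lemma shuffle_in_Shuf:
  "p \<in> Ass X i \<Longrightarrow> q \<in> Ass X j \<Longrightarrow> i \<ge> 1 \<Longrightarrow> j \<ge> 1 \<Longrightarrow> i + j = k \<Longrightarrow> shuffle p q \<in> Shuf X k"
  unfolding Shuf_def by (rule nc.span_base) blast

section \<open>Closure properties of the free Lie algebra\<close>

lemma lie_subalgebra_free_Lie: "lie_subalgebra (free_Lie X)"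
proof -
  have "lie_subalgebra (\<Inter> T)" if "Ball T lie_subalgebra" for T :: "('x, 'k::field) ncpoly set set"
    using that by (auto simp: lie_subalgebra_def intro!: nc.subspace_Inter)
  then show ?thesis
    unfolding free_Lie_def by (rule hull_in)
qed

lemma subspace_free_Lie: "nc.subspace (free_Lie X)"
  by (rule conjunct1[OF lie_subalgebra_free_Lie[unfolded lie_subalgebra_def]])

lemma bracket_in_free_Lie:
  "p \<in> free_Lie X \<Longrightarrow> q \<in> free_Lie X \<Longrightarrow> p * q - q * p \<in> free_Lie X"
  by (rule conjunct2[OF lie_subalgebra_free_Lie[unfolded lie_subalgebra_def], rule_format])

lemma subspace_Lie: "nc.subspace (Lie X k)"
  unfolding Lie_def by (intro nc.subspace_inter subspace_free_Lie subspace_Ass)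

subsection \<open>The Dynkin operator and its adjoint\<close>

fun dynkin :: "'x list \<Rightarrow> ('x, 'k::field) ncpoly" where
  "dynkin [] = 0"
| "dynkin [x] = gen x"
| "dynkin (x # y # u) = gen x * dynkin (y # u) - dynkin (y # u) * gen x"

text \<open>The transpose of \<open>dynkin\<close>: there a letter is attached before or after the
  bracketing of the rest, so here a letter is stripped from the front or the end of the word and put
  in front. The value 0 on the empty word fits its degree.\<close>

function dynkin_adj :: "'x list \<Rightarrow> ('x, 'k::field) ncpoly" where
  "dynkin_adj [] = 0"
| "dynkin_adj [x] = gen x"
| "dynkin_adj (x # y # u) =
    gen x * dynkin_adj (y # u) - gen (last (y # u)) * dynkin_adj (x # butlast (y # u))"
  by pat_completeness auto
termination by (relation "measure length") auto

lemma dynkin_in_free_Lie: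
  "set w \<subseteq> X \<Longrightarrow> (dynkin w :: ('x, 'k::field) ncpoly) \<in> free_Lie X"
proof (induction w rule: dynkin.induct)
  case 1
  show ?case
    by (simp add: nc.subspace_0[OF subspace_free_Lie])
next
  case (2 x)
  then show ?case by (simp add: free_Lie_def hull_inc)
next
  case (3 x y u)
  moreover have "(gen x :: ('x, 'k) ncpoly) \<in> free_Lie X"
    using 3 by (simp add: free_Lie_def hull_inc)
  ultimately show ?case
    by (simp add: bracket_in_free_Lie)
qed

lemma dynkin_in_Ass: "set w \<subseteq> X \<Longrightarrow> dynkin w \<in> Ass X (length w)"
proof (induction w rule: dynkin.induct)
  case (2 x)
  then show ?case using monom_in_Ass[of "[x]" X] by simp
next
  case (3 x y u)
  then show ?case
    by (auto intro!: nc.subspace_diff[OF subspace_Ass] gen_mult_in_Ass[of x X _ "Suc (length u)"]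
        mult_gen_in_Ass[of x X _ "Suc (length u)"])
qed (simp add: nc.subspace_0[OF subspace_Ass])

lemma dynkin_adj_in_Ass:
  "set w \<subseteq> X \<Longrightarrow> (dynkin_adj w :: ('x, 'k::field) ncpoly) \<in> Ass X (length w)"
proof (induction w rule: dynkin_adj.induct)
  case (2 x)
  then show ?case using monom_in_Ass[of "[x]" X] by simp
next
  case (3 x y u)
  have *: "last (y # u) \<in> X" "set (x # butlast (y # u)) \<subseteq> X"
    using 3(3) last_in_set[of "y # u"] in_set_butlastD[of _ "y # u"]
    by (auto simp del: last.simps butlast.simps)
  then have "gen (last (y # u)) * (dynkin_adj (x # butlast (y # u)) :: ('x, 'k) ncpoly)
      \<in> Ass X (Suc (length (x # butlast (y # u))))"
    by (intro gen_mult_in_Ass 3(2))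
  moreover have "length (x # butlast (y # u)) = length (y # u)"
    by simp
  moreover have "gen x * (dynkin_adj (y # u) :: ('x, 'k) ncpoly) \<in> Ass X (Suc (length (y # u)))"
    using 3(3) by (intro gen_mult_in_Ass 3(1)) auto
  ultimately show ?case
    unfolding dynkin_adj.simps(3) length_Cons[of x] by (metis nc.subspace_diff[OF subspace_Ass])
qed (simp add: nc.subspace_0[OF subspace_Ass])

lemma lookup_dynkin_Nil: "Poly_Mapping.lookup (dynkin u) (Word []) = 0"
  by (induction u rule: dynkin.induct)
    (auto simp: lookup_monom lookup_minus lookup_gen_mult lookup_mult_gen)

lemma lookup_dynkin_adj_Nil: "Poly_Mapping.lookup (dynkin_adj u) (Word []) = 0"
  by (cases u rule: dynkin_adj.cases)
    (auto simp: lookup_monom lookup_minus lookup_gen_mult)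

text \<open>The matrices of \<open>dynkin\<close> and \<open>dynkin_adj\<close> are transposes: both
  coefficients reduce by comparing the first letter of \<open>u\<close> with the first and the last
  letter of \<open>v\<close>.\<close>

lemma lookup_dynkin:
  "Poly_Mapping.lookup (dynkin u) (Word v) = (Poly_Mapping.lookup (dynkin_adj v) (Word u) :: 'k::field)"
proof (induction v arbitrary: u rule: dynkin_adj.induct)
  case 1
  then show ?case by (simp add: lookup_dynkin_Nil)
next
  case (2 a)
  show ?case
    by (cases u rule: dynkin.cases)
      (auto simp: lookup_monom lookup_minus lookup_gen_mult lookup_mult_gen lookup_dynkin_Nil)
next
  case (3 a b v)
  show ?case
  proof (cases u rule: dynkin.cases)
    case 1
    then show ?thesis by (simp add: lookup_minus lookup_gen_mult)
  next
    case (2 x)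
    then show ?thesis
      by (simp add: lookup_monom lookup_minus lookup_gen_mult lookup_dynkin_adj_Nil)
  next
    case (3 x y u')
    have "last (a # b # v) = last (b # v)" "butlast (a # b # v) = a # butlast (b # v)"
      by simp_all
    then show ?thesis
      using "3.IH"(1)[of "y # u'"] "3.IH"(2)[of "y # u'"]
      by (simp add: 3 lookup_minus lookup_gen_mult lookup_mult_gen del: last.simps butlast.simps)
  qed
qed

text \<open>
  Dual to the convolution identity \<open>D \<star> id = deg\<close>. In the induction, the terms that strip the last
  letter off the first factor cancel against those that strip the first letter off the second;
  \<open>G\<close> below collects them.
\<close>

lemma sum_shuffle_dynkin_adj:
  "(\<Sum>i\<le>length w. shuffle (dynkin_adj (take i w)) (monom (drop i w))) =
    scale (of_nat (length w)) (monom w :: ('x, 'k::field) ncpoly)"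
proof (induction w)
  case Nil
  show ?case by (simp add: shuffle_linear_simps)
next
  case (Cons a w)
  let ?n = "length w"
  let ?r = "dynkin_adj :: _ \<Rightarrow> ('x, 'k) ncpoly"
  define G where "G i = (if i < ?n
    then gen (w ! i) * shuffle (?r (a # take i w)) (monom (drop (Suc i) w)) else 0)" for i
  \<comment> \<open>Both factors are expanded by their leading letters. The extra monomial at
    \<open>i = 0\<close> comes from the start value \<open>dynkin_adj [a] = gen a\<close>.\<close>
  have step: "shuffle (?r (a # take i w)) (monom (drop i w)) =
      (if i = 0 then monom (a # w) else 0) +
      gen a * shuffle (?r (take i w)) (monom (drop i w)) + (G i - (if i = 0 then 0 else G (i - 1)))"
    if "i \<le> ?n" for i
  proof (cases i)
    case 0
    then show ?thesis
    proof (cases w)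
      case (Cons b w')
      show ?thesis
        using shuffle_gen_mult[of a 1 b "monom w'"]
        by (simp add: 0 G_def Cons gen_mult_monom shuffle_linear_simps)
    qed (simp add: G_def shuffle_linear_simps monom_Nil)
  next
    case (Suc j)
    have ne: "take i w \<noteq> []" using that Suc by (cases w) auto
    have last: "last (take i w) = w ! j" "butlast (take i w) = take j w"
      using that Suc by (simp_all add: last_conv_nth[OF ne[unfolded Suc]] butlast_take min_def)
    have r: "?r (a # take i w) = gen a * ?r (take i w) - gen (w ! j) * ?r (a # take j w)"
      using dynkin_adj.simps(3)[of a "hd (take i w)" "tl (take i w)"] ne
      unfolding last[symmetric] by (metis list.collapse)
    have G: "(if i = 0 then 0 else G (i - 1)) =
        gen (w ! j) * shuffle (?r (a # take j w)) (monom (drop i w))"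
      using that Suc by (simp add: G_def)
    show ?thesis
    proof (cases "i = ?n")
      case True
      then show ?thesis
        unfolding G r using Suc by (auto simp: G_def monom_Nil)
    next
      case False
      define x v where "x = w ! i" and "v = drop (Suc i) w"
      have drop: "drop i w = x # v"
        using False that by (simp add: Cons_nth_drop_Suc x_def v_def)
      have "shuffle (?r (a # take i w)) (monom (drop i w)) =
          shuffle (gen a * ?r (take i w)) (gen x * monom v) -
          shuffle (gen (w ! j) * ?r (a # take j w)) (gen x * monom v)"
        by (simp add: r drop gen_mult_monom shuffle_linear_simps)
      also have "\<dots> = gen a * shuffle (?r (take i w)) (gen x * monom v) +
          gen x * shuffle (?r (a # take i w)) (monom v) -
          gen (w ! j) * shuffle (?r (a # take j w)) (gen x * monom v)"
        by (simp add: shuffle_gen_mult r shuffle_linear_simps right_diff_distrib)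
      finally show ?thesis
        using False that Suc drop by (simp add: G_def gen_mult_monom x_def v_def)
    qed
  qed
  \<comment> \<open>At \<open>length w\<close> the second factor is exhausted and \<open>G\<close>
    is 0, so the telescoping sum contributes nothing.\<close>
  have telescope: "(\<Sum>i\<le>n. G i - (if i = 0 then 0 else G (i - 1))) = G n" for n
    by (induction n) auto
  \<comment> \<open>The term at \<open>i = 0\<close> vanishes because
    \<open>dynkin_adj [] = 0\<close>.\<close>
  have "(\<Sum>i\<le>length (a # w). shuffle (?r (take i (a # w))) (monom (drop i (a # w)))) =
      (\<Sum>i\<le>?n. shuffle (?r (a # take i w)) (monom (drop i w)))"
    by (simp add: sum.atMost_Suc_shift shuffle_linear_simps del: sum.atMost_Suc)
  also have "\<dots> = (\<Sum>i\<le>?n. (if i = 0 then monom (a # w) else 0) +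
      gen a * shuffle (?r (take i w)) (monom (drop i w)) + (G i - (if i = 0 then 0 else G (i - 1))))"
    by (intro sum.cong refl step) simp
  also have "\<dots> = monom (a # w) + gen a * scale (of_nat ?n) (monom w)"
    unfolding sum.distrib telescope by (simp add: Cons.IH G_def flip: sum_distrib_left)
  also have "\<dots> = scale (of_nat (length (a # w))) (monom (a # w))"
    by (simp add: mult_scale_right gen_mult_monom nc.scale_left_distrib)
  finally show ?case .
qed

text \<open>In \<open>sum_shuffle_dynkin_adj\<close> the term for the full word is
  \<open>dynkin_adj w\<close>, the term at \<open>i = 0\<close> vanishes, and those strictly between
  are proper shuffles.\<close>

lemma scale_monom_cong_dynkin_adj:
  fixes w :: "'x list"
  assumes "set w \<subseteq> X" "length w = k"
  shows "scale (of_nat k) (monom w) - dynkin_adj w \<in> (Shuf X k :: ('x, 'k::field) ncpoly set)"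
proof -
  let ?f = "\<lambda>i. shuffle (dynkin_adj (take i w)) (monom (drop i w)) :: ('x, 'k) ncpoly"
  have *: "dynkin_adj w + (\<Sum>i<k. ?f i) = scale (of_nat k) (monom w)"
    using sum_shuffle_dynkin_adj[of w] assms(2)
    by (simp add: monom_Nil lessThan_Suc_atMost[symmetric] add.commute)
  have "scale (of_nat k) (monom w) - dynkin_adj w = (\<Sum>i<k. ?f i)"
    unfolding *[symmetric] by simp
  also have "\<dots> \<in> Shuf X k"
  proof (rule nc.subspace_sum[OF subspace_Shuf])
    fix i assume "i \<in> {..<k}"
    then have i: "i < k" by simp
    show "?f i \<in> Shuf X k"
    proof (cases "i = 0")
      case True
      then show ?thesis
        by (simp add: shuffle_linear_simps nc.subspace_0[OF subspace_Shuf])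
    next
      case False
      have "set (take i w) \<subseteq> X" "set (drop i w) \<subseteq> X"
        using assms(1) by (auto dest: in_set_takeD in_set_dropD)
      then have "(dynkin_adj (take i w) :: ('x, 'k) ncpoly) \<in> Ass X i"
        "(monom (drop i w) :: ('x, 'k) ncpoly) \<in> Ass X (k - i)"
        using dynkin_adj_in_Ass[of "take i w" X] monom_in_Ass[of "drop i w" X] assms(2) i by auto
      then show ?thesis
        by (rule shuffle_in_Shuf) (use False i in auto)
    qed
  qed
  finally show ?thesis .
qed

text \<open>\<open>R\<close> is the linear extension of \<open>dynkin_adj\<close> applied to
  \<open>p\<close>. Orthogonality to all brackets gives \<open>R = 0\<close> by adjointness, so
  \<open>k\<close> times \<open>p\<close> lies in \<open>Shuf X k\<close>; and \<open>k\<close> is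
  invertible in characteristic zero.\<close>

lemma orthogonal_dynkin_imp_Shuf:
  fixes p :: "('x, 'k::field_char_0) ncpoly"
  assumes p: "p \<in> Ass X k" and k: "k \<ge> 1"
    and orth: "\<And>w. set w \<subseteq> X \<Longrightarrow> length w = k \<Longrightarrow> pairing p (dynkin w) = 0"
  shows "p \<in> Shuf X k"
proof -
  let ?K = "Poly_Mapping.keys p" and ?c = "Poly_Mapping.lookup p"
  define R where "R = (\<Sum>w\<in>?K. scale (?c w) (dynkin_adj (letters w)))"
  have K: "set (letters w) \<subseteq> X" "length (letters w) = k" if "w \<in> ?K" for w
    using p that by (auto simp: Ass_def)
  have "dynkin_adj (letters w) \<in> Ass X k" if "w \<in> ?K" for w
    using dynkin_adj_in_Ass[OF K(1)[OF that]] K(2)[OF that] by simp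
  then have "R \<in> Ass X k"
    unfolding R_def by (intro nc.subspace_sum[OF subspace_Ass] nc.subspace_scale[OF subspace_Ass])
  \<comment> \<open>On words over \<open>X\<close> of length \<open>k\<close> the coefficient of
    \<open>R\<close> is a pairing of \<open>p\<close> with a bracket; elsewhere it vanishes by
    homogeneity.\<close>
  have "Poly_Mapping.lookup R u = 0" for u
  proof (cases "set (letters u) \<subseteq> X \<and> length (letters u) = k")
    case True
    have "Poly_Mapping.lookup R u = (\<Sum>w\<in>?K. ?c w * Poly_Mapping.lookup (dynkin_adj (letters w)) u)"
      by (simp add: R_def lookup_sum)
    also have "\<dots> = (\<Sum>w\<in>?K. ?c w * Poly_Mapping.lookup (dynkin (letters u)) w)"
      by (intro sum.cong refl arg_cong2[where f = "(*)"])
        (metis lookup_dynkin word.collapse)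
    also have "\<dots> = pairing p (dynkin (letters u))"
      by (simp add: pairing_eq_sum[of ?K])
    finally show ?thesis using orth True by simp
  next
    case False
    then show ?thesis
      using \<open>R \<in> Ass X k\<close> by (auto simp: Ass_def in_keys_iff)
  qed
  then have "R = 0" by (intro poly_mapping_eqI) simp
  have "scale (of_nat k) p = (\<Sum>w\<in>?K. scale (?c w) (scale (of_nat k) (monom (letters w))))"
    by (subst ncpoly_expand_monom[of p, symmetric]) (simp add: nc.scale_sum_right mult.commute)
  also have "\<dots> = (\<Sum>w\<in>?K. scale (?c w) (scale (of_nat k) (monom (letters w)) - dynkin_adj (letters w))) + R"
    by (simp add: R_def nc.scale_right_diff_distrib sum_subtractf)
  also have "\<dots> \<in> Shuf X k"
    unfolding \<open>R = 0\<close> add_0_right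
    by (intro nc.subspace_sum[OF subspace_Shuf] nc.subspace_scale[OF subspace_Shuf]
        scale_monom_cong_dynkin_adj K)
  finally have "scale (inverse (of_nat k)) (scale (of_nat k) p) \<in> Shuf X k"
    by (rule nc.subspace_scale[OF subspace_Shuf])
  then show ?thesis
    using k by simp
qed

subsection \<open>Orthogonal projection for rational coefficients\<close>

text \<open>In characteristic zero \<open>\<rat>\<close> is a copy of the rational numbers inside
  \<open>'k\<close>, so the order of the rationals can be used although \<open>'k\<close> need not
  be ordered.\<close>

definition rational_coeffs :: "('x, 'k::field_char_0) ncpoly \<Rightarrow> bool" where
  "rational_coeffs p \<longleftrightarrow> (\<forall>w. Poly_Mapping.lookup p w \<in> \<rat>)"

lemma rational_coeffs_monom: "rational_coeffs (monom w)"
  by (simp add: rational_coeffs_def lookup_monom)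

lemma rational_coeffs_add: "rational_coeffs p \<Longrightarrow> rational_coeffs q \<Longrightarrow> rational_coeffs (p + q)"
  by (simp add: rational_coeffs_def lookup_add)

lemma rational_coeffs_diff: "rational_coeffs p \<Longrightarrow> rational_coeffs q \<Longrightarrow> rational_coeffs (p - q)"
  by (simp add: rational_coeffs_def lookup_minus)

lemma rational_coeffs_scale: "c \<in> \<rat> \<Longrightarrow> rational_coeffs p \<Longrightarrow> rational_coeffs (scale c p)"
  by (simp add: rational_coeffs_def)

lemma rational_coeffs_dynkin: "rational_coeffs (dynkin w :: ('x, 'k::field_char_0) ncpoly)"
proof (induction w rule: dynkin.induct)
  case (3 x y u)
  let ?D = "dynkin (y # u) :: ('x, 'k) ncpoly"
  have "Poly_Mapping.lookup (gen x * ?D) v \<in> \<rat>" "Poly_Mapping.lookup (?D * gen x) v \<in> \<rat>" for v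
    using 3 by (cases v, simp add: rational_coeffs_def lookup_gen_mult lookup_mult_gen)+
  then show ?case
    by (simp add: rational_coeffs_def lookup_minus)
qed (simp_all add: rational_coeffs_monom, simp add: rational_coeffs_def)

lemma pairing_in_Rats:
  assumes "rational_coeffs p" "rational_coeffs q"
  shows "pairing p q \<in> \<rat>"
  unfolding pairing_eq_sum[OF finite_keys order_refl]
  by (rule Rats_sum) (use assms in \<open>simp add: rational_coeffs_def\<close>)

text \<open>The self-pairing is the image under \<open>of_rat\<close> of a sum of rational squares,
  which is zero only if every square is.\<close>

lemma pairing_self_eq_0:
  fixes p :: "('x, 'k::field_char_0) ncpoly"
  assumes "rational_coeffs p" "pairing p p = 0"
  shows "p = 0"
proof -
  have "\<forall>w. \<exists>r. Poly_Mapping.lookup p w = of_rat r"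
    using assms(1) by (auto simp: rational_coeffs_def Rats_def)
  then obtain r where r: "\<And>w. Poly_Mapping.lookup p w = of_rat (r w)"
    by metis
  have "of_rat (\<Sum>w\<in>Poly_Mapping.keys p. r w * r w) = pairing p p"
    by (simp add: pairing_eq_sum[OF finite_keys order_refl] r of_rat_sum of_rat_mult)
  then have "(\<Sum>w\<in>Poly_Mapping.keys p. r w * r w) = 0"
    by (simp add: assms(2))
  then have "r w = 0" if "w \<in> Poly_Mapping.keys p" for w
    using that by (subst (asm) sum_nonneg_eq_0_iff) auto
  then have "Poly_Mapping.lookup p w = 0" for w
    by (cases "w \<in> Poly_Mapping.keys p") (auto simp: r in_keys_iff)
  then show ?thesis
    by (intro poly_mapping_eqI) simp
qed

lemma subspace_orthogonal: "nc.subspace {q. pairing p q = 0}"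
  by (rule nc.subspaceI) (simp_all add: pairing_right_simps)

lemma pairing_span_eq_0:
  assumes "q \<in> nc.span B" "\<And>b. b \<in> B \<Longrightarrow> pairing p b = 0"
  shows "pairing p q = 0"
  using assms(1) by (rule nc.span_induct) (use assms(2) subspace_orthogonal in auto)

text \<open>
  Over \<open>'k\<close> itself the form may have isotropic vectors, so orthogonal projections need not exist;
  rational coefficients make the form definite.
\<close>

lemma rational_orthogonal_projection:
  fixes p :: "('x, 'k::field_char_0) ncpoly"
  assumes "finite B" "\<And>b. b \<in> B \<Longrightarrow> rational_coeffs b" "rational_coeffs p"
  shows "\<exists>u. u \<in> nc.span B \<and> rational_coeffs u \<and> (\<forall>b\<in>B. pairing (p - u) b = 0)"
  using assms
proof (induction B arbitrary: p rule: finite_induct)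
  case empty
  then show ?case by (intro exI[of _ 0]) (simp add: rational_coeffs_def)
next
  case (insert b B)
  \<comment> \<open>A Gram-Schmidt step: the induction hypothesis is applied to the new vector
    \<open>b\<close> as well as to \<open>p\<close>.\<close>
  obtain b' where b': "b' \<in> nc.span B" "rational_coeffs b'" "\<And>c. c \<in> B \<Longrightarrow> pairing (b - b') c = 0"
    using insert.IH[of b] insert.prems by auto
  obtain p' where p': "p' \<in> nc.span B" "rational_coeffs p'" "\<And>c. c \<in> B \<Longrightarrow> pairing (p - p') c = 0"
    using insert.IH[of p] insert.prems by auto
  \<comment> \<open>\<open>d\<close> is the part of \<open>b\<close> orthogonal to \<open>B\<close>,
    so correcting \<open>p'\<close> along \<open>d\<close> keeps \<open>p - u\<close> orthogonal to
    \<open>B\<close>. If \<open>pairing d d = 0\<close>, division yields \<open>a = 0\<close>, and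
    \<open>d = 0\<close> by definiteness.\<close>
  define d where "d = b - b'"
  define a where "a = pairing (p - p') d / pairing d d"
  define u where "u = p' + scale a d"
  have d: "rational_coeffs d"
    using b' insert.prems by (simp add: d_def rational_coeffs_diff)
  have "a \<in> \<rat>"
    unfolding a_def using d p'(2) insert.prems
    by (intro Rats_divide pairing_in_Rats rational_coeffs_diff) auto
  have span: "nc.span B \<subseteq> nc.span (insert b B)"
    by (rule nc.span_mono) auto
  have "u \<in> nc.span (insert b B)"
    unfolding u_def d_def using b'(1) p'(1) span
    by (intro nc.span_add nc.span_scale nc.span_diff) (auto intro: nc.span_base)
  moreover have "rational_coeffs u"
    unfolding u_def using p'(2) d \<open>a \<in> \<rat>\<close> by (intro rational_coeffs_add rational_coeffs_scale)
  moreover have orth: "pairing (p - u) c = 0" if "c \<in> B" for c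
    using b'(3)[OF that] p'(3)[OF that] by (simp add: u_def d_def pairing_left_simps)
  moreover have "pairing (p - u) b = 0"
  proof -
    have "pairing (p - u) b' = 0"
      using b'(1) orth by (rule pairing_span_eq_0)
    moreover have "pairing (p - u) d = 0"
    proof (cases "pairing d d = 0")
      case True
      then have "d = 0" using d by (rule pairing_self_eq_0[rotated])
      then show ?thesis by (simp add: pairing_right_simps)
    next
      case False
      have "pairing (p - u) d = pairing (p - p') d - a * pairing d d"
        by (simp add: u_def pairing_left_simps)
      then show ?thesis using False by (simp add: a_def)
    qed
    ultimately have "pairing (p - u) (b' + d) = 0"
      by (simp add: pairing_right_simps)
    then show ?thesis by (simp add: d_def)
  qed
  ultimately show ?case by blast
qed

section \<open>The direct sum decomposition\<close>

text \<open>A general \<open>p\<close> need not have rational coefficients, but monomials do; they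
  are projected one by one and span \<open>Ass X k\<close>. As \<open>X\<close> is finite, there are
  finitely many brackets of degree \<open>k\<close> to project onto.\<close>

lemma Ass_eq_Lie_plus_Shuf:
  fixes p :: "('x, 'k::field_char_0) ncpoly"
  assumes "finite X" "k \<ge> 1" "p \<in> Ass X k"
  shows "\<exists>l\<in>Lie X k. \<exists>s\<in>Shuf X k. p = l + s"
proof -
  let ?W = "{w. set w \<subseteq> X \<and> length w = k}"
  let ?B = "dynkin ` ?W :: ('x, 'k) ncpoly set"
  let ?V = "{l + s | l s. l \<in> Lie X k \<and> s \<in> (Shuf X k :: ('x, 'k) ncpoly set)}"
  have "finite ?B"
    using finite_lists_length_eq[OF assms(1), of k] by simp
  have "?B \<subseteq> Lie X k"
    by (auto simp: Lie_def intro!: dynkin_in_free_Lie dynkin_in_Ass)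
  then have B: "nc.span ?B \<subseteq> Lie X k"
    by (rule nc.span_minimal) (rule subspace_Lie)
  have "monom w \<in> ?V" if w: "w \<in> ?W" for w
  proof -
    obtain u where u: "u \<in> nc.span ?B" "\<And>b. b \<in> ?B \<Longrightarrow> pairing (monom w - u) b = 0"
      using rational_orthogonal_projection[OF \<open>finite ?B\<close>, of "monom w"]
        rational_coeffs_dynkin rational_coeffs_monom by blast
    have "u \<in> Lie X k" using B u(1) by blast
    moreover have "monom w - u \<in> Ass X k"
      using monom_in_Ass[of w X] w \<open>u \<in> Lie X k\<close>
      by (intro nc.subspace_diff[OF subspace_Ass]) (auto simp: Lie_def)
    then have "monom w - u \<in> Shuf X k"
      using assms(2) by (rule orthogonal_dynkin_imp_Shuf) (use u(2) in auto)
    moreover have "monom w = u + (monom w - u)" by simp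
    ultimately show ?thesis by blast
  qed
  then have "nc.span (monom ` ?W) \<subseteq> ?V"
    by (intro nc.span_minimal nc.subspace_sums subspace_Lie subspace_Shuf) auto
  then show ?thesis
    using Ass_span_monom[OF assms(3)] by blast
qed

text \<open>An element of both spaces is orthogonal to each, hence to their sum
  \<open>Ass X k\<close>, and pairing it with monomials reads off its coefficients. Since
  \<open>'k\<close> may admit isotropic vectors, \<open>pairing p p = 0\<close> alone would not
  suffice.\<close>

lemma Lie_Int_Shuf:
  assumes "finite X" "k \<ge> 1" "p \<in> Lie X k" "p \<in> Shuf X k"
  shows "p = (0 :: ('x, 'k::field_char_0) ncpoly)"
proof -
  have p: "p \<in> Ass X k" using assms(3) by (simp add: Lie_def)
  have orth: "pairing p q = 0" if "q \<in> Ass X k" for q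
  proof -
    obtain l s where "q = l + s" "l \<in> Lie X k" "s \<in> Shuf X k"
      using Ass_eq_Lie_plus_Shuf[OF assms(1,2) \<open>q \<in> _\<close>] by blast
    then show ?thesis
      using pairing_Shuf_Lie[OF assms(4)] pairing_Shuf_Lie[OF _ assms(3)]
      by (simp add: pairing_right_simps pairing_commute[of p s])
  qed
  have "Poly_Mapping.lookup p w = 0" if "w \<in> Poly_Mapping.keys p" for w
  proof -
    have "set (letters w) \<subseteq> X" "length (letters w) = k"
      using p that by (auto simp: Ass_def)
    then have "pairing p (monom (letters w)) = 0"
      using orth monom_in_Ass by blast
    then show ?thesis
      by (simp add: pairing_commute[of p] pairing_monom_left)
  qed
  then show ?thesis
    by (intro poly_mapping_eqI) (auto simp: in_keys_iff)
qed

theorem theorem2: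
  fixes X :: "'x set" and k :: nat
  assumes "finite X" and "k \<ge> 1"
  shows "nc.subspace (Lie X k :: ('x, 'k::field_char_0) ncpoly set)
    \<and> nc.subspace (Shuf X k :: ('x, 'k) ncpoly set)
    \<and> Lie X k \<subseteq> (Ass X k :: ('x, 'k) ncpoly set)
    \<and> Shuf X k \<subseteq> (Ass X k :: ('x, 'k) ncpoly set)
    \<and> (\<forall>s \<in> Shuf X k. \<forall>l \<in> Lie X k. pairing s (l :: ('x, 'k) ncpoly) = 0)
    \<and> (Ass X k :: ('x, 'k) ncpoly set) = {l + s | l s. l \<in> Lie X k \<and> s \<in> Shuf X k}
    \<and> Lie X k \<inter> Shuf X k = {0 :: ('x, 'k) ncpoly}"
proof (intro conjI subspace_Lie subspace_Shuf Shuf_subset_Ass ballI)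
  show Lie: "Lie X k \<subseteq> (Ass X k :: ('x, 'k) ncpoly set)"
    by (simp add: Lie_def)
  show "pairing s l = 0" if "s \<in> Shuf X k" "l \<in> Lie X k" for s l :: "('x, 'k) ncpoly"
    using that by (rule pairing_Shuf_Lie)
  show "(Ass X k :: ('x, 'k) ncpoly set) = {l + s | l s. l \<in> Lie X k \<and> s \<in> Shuf X k}"
  proof
    show "Ass X k \<subseteq> {l + s | l s. l \<in> Lie X k \<and> s \<in> (Shuf X k :: ('x, 'k) ncpoly set)}"
      using Ass_eq_Lie_plus_Shuf[OF assms] by blast
    show "{l + s | l s. l \<in> Lie X k \<and> s \<in> Shuf X k} \<subseteq> (Ass X k :: ('x, 'k) ncpoly set)"
      using Lie Shuf_subset_Ass nc.subspace_add[OF subspace_Ass] by blast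
  qed
  show "Lie X k \<inter> Shuf X k = {0 :: ('x, 'k) ncpoly}"
    using Lie_Int_Shuf[OF assms] nc.subspace_0[OF subspace_Lie] nc.subspace_0[OF subspace_Shuf]
    by blast
qed

end
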